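(* Let $H$ be a Hopf algebra over $\mathbb{C}$ with invertible antipode and let $A$ be a left $H$-module algebra. Then every ${}_AH$-SAYD module $M$ is an ${}_AH$-HCC; that is, the operators $d_i,s_i,t_n$ given in the context are well defined on $C^n_H(A,M)=\mathrm{Hom}_H(M\otimes A^{\otimes(n+1)},\mathbb{C})$, $n\ge0$, and turn $C^*_H(A,M)$ into a cocyclic module.
   Context: Work over $\mathbb{C}$. $S$ is the antipode and $\varepsilon$ the counit of $H$. Sweedler notation: $\Delta(h)=h^{(1)}\otimes h^{(2)}$ and similarly for iterated coproducts; left coactions are written $m\mapsto m_{\langle -1\rangle}\otimes m_{\langle 0\rangle}$. A left $H$-module algebra is a unital algebra $A$ with a left $H$-action such that $h(ab)=(h^{(1)}a)(h^{(2)}b)$ and $h1=\varepsilon(h)1$. $H$ acts diagonally on $A^{\otimes n}$. A right-left module-comodule over $H$ is a vector space $M$ that is a right $H$-module and a left $H$-comodule (no compatibility assumed). For such $M$, $M\otimes A^{\otimes(n+1)}$ is a right $H$-module via $(m\otimes\tilde a)h=mh^{(1)}\otimes S(h^{(2)})\tilde a$, and $\mathbb{C}$ is a right $H$-module via $rh=\varepsilon(h)r$. $C^n_H(A,M)=\mathrm{Hom}_H(M\otimes A^{\otimes(n+1)},\mathbb{C})$ is the space of right $H$-linear maps. ${}_AH$-SAYD module: a right-left module-comodule $M$ over $H$ such that for all $m\in M$, $h\in H$, $a\in A$, $n\ge0$, $\tilde a=a_0\otimes\dots\otimes a_n\in A^{\otimes(n+1)}$ and $\varphi\in C^n_H(A,M)$: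 (i) $S^{-1}((mh)_{\langle -1\rangle})a\otimes(mh)_{\langle 0\rangle}=S^{-1}(m_{\langle -1\rangle}h^{(1)})h^{(3)}a\otimes m_{\langle 0\rangle}h^{(2)}$; (ii) $\varphi(m_{\langle 0\rangle}\otimes S^{-1}(m_{\langle -1\rangle})\tilde a)=\varphi(m\otimes\tilde a)$ (diagonal action on $A^{\otimes(n+1)}$). Operators, with $\tilde a=a_0\otimes\dots\otimes a_n$: $(d_if)(m\otimes\tilde a)=f(m\otimes a_0\otimes\dots\otimes a_ia_{i+1}\otimes\dots\otimes a_n)$ for $0\le i<n$; $(d_nf)(m\otimes\tilde a)=f(m_{\langle 0\rangle}\otimes(S^{-1}(m_{\langle -1\rangle})a_n)a_0\otimes a_1\otimes\dots\otimes a_{n-1})$; $(s_if)(m\otimes\tilde a)=f(m\otimes a_0\otimes\dots\otimes a_i\otimes1\otimes a_{i+1}\otimes\dots\otimes a_n)$ for $0\le i\le n$; $(t_nf)(m\otimes\tilde a)=f(m_{\langle 0\rangle}\otimes S^{-1}(m_{\langle -1\rangle})a_n\otimes a_0\otimes\dots\otimes a_{n-1})$. Here $d_i$ maps degree $n-1$ to degree $n$, $s_i$ maps degree $n+1$ to degree $n$, and $t_n$ maps degree $n$ to itself. "Well defined" means that the operators map $H$-linear functionals to $H$-linear functionals. A cocyclic module is a cosimplicial module (cofaces $d_i$, codegeneracies $s_i$) with operators $t_n$ satisfying $t_nd_i=d_{i-1}t_{n-1}$ ($1\le i\le n$), $t_nd_0=d_n$, $t_ns_i=s_{i-1}t_{n+1}$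 ($1\le i\le n$), $t_ns_0=s_nt_{n+1}^2$, and $t_n^{n+1}=\mathrm{Id}$. *)

theory Defs
  imports Complex_Main "HOL-Library.Poly_Mapping" "HOL-Library.Function_Algebras"
begin

section \<open>Complex vector spaces and unital algebras\<close>

class complex_vector = ab_group_add +
  fixes scaleC :: "complex \<Rightarrow> 'a \<Rightarrow> 'a"  (infixr \<open>*\<^sub>C\<close> 75)
  assumes scaleC_add_right: "c *\<^sub>C (x + y) = c *\<^sub>C x + c *\<^sub>C y"
    and scaleC_add_left: "(c + d) *\<^sub>C x = c *\<^sub>C x + d *\<^sub>C x"
    and scaleC_scaleC: "c *\<^sub>C d *\<^sub>C x = (c * d) *\<^sub>C x"
    and scaleC_one: "1 *\<^sub>C x = x"

text \<open>Built on \<^class>\<open>ring\<close> and \<^class>\<open>monoid_mult\<close> rather than \<^class>\<open>ring_1\<close>, so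
  that the zero algebra is not excluded.\<close>

class complex_unital_algebra = complex_vector + ring + monoid_mult +
  assumes scaleC_mult_left: "(c *\<^sub>C x) * y = c *\<^sub>C (x * y)"
    and scaleC_mult_right: "x * (c *\<^sub>C y) = c *\<^sub>C (x * y)"

global_interpretation complex_vector: vector_space "scaleC :: complex \<Rightarrow> 'a::complex_vector \<Rightarrow> 'a"
  by standard (simp_all add: scaleC_add_right scaleC_add_left scaleC_scaleC scaleC_one)

instantiation complex :: complex_unital_algebra
begin
definition "scaleC_complex = ((*) :: complex \<Rightarrow> complex \<Rightarrow> complex)"
instance
  by standard (simp_all add: scaleC_complex_def algebra_simps)
end

instantiation "fun" :: (type, complex_vector) complex_vector
begin
definition "scaleC_fun c f = (\<lambda>x. c *\<^sub>C f x)"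
instance
  by standard (simp_all add: scaleC_fun_def fun_eq_iff scaleC_add_right scaleC_add_left
      scaleC_scaleC scaleC_one)
end

instantiation poly_mapping :: (type, complex_vector) complex_vector
begin
definition "scaleC_poly_mapping c p = Poly_Mapping.map (scaleC c) p"

lemma lookup_scaleC: "Poly_Mapping.lookup (c *\<^sub>C p) k = c *\<^sub>C Poly_Mapping.lookup p k"
  for p :: "('a, 'b) poly_mapping"
  by (auto simp: scaleC_poly_mapping_def map.rep_eq when_def)

instance
  by standard (simp_all add: poly_mapping_eq_iff fun_eq_iff lookup_scaleC lookup_add
      scaleC_add_right scaleC_add_left scaleC_scaleC scaleC_one)
end

abbreviation clinear :: "('a::complex_vector \<Rightarrow> 'b::complex_vector) \<Rightarrow> bool"
  where "clinear \<equiv> Vector_Spaces.linear scaleC scaleC"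

definition cbilinear :: "('a::complex_vector \<Rightarrow> 'b::complex_vector \<Rightarrow> 'c::complex_vector) \<Rightarrow> bool"
  where "cbilinear f \<longleftrightarrow> (\<forall>a. clinear (f a)) \<and> (\<forall>b. clinear (\<lambda>a. f a b))"

text \<open>Linearity of a map whose source is a subspace \<open>V\<close>.\<close>

definition clinear_on :: "'a::complex_vector set \<Rightarrow> ('a \<Rightarrow> 'b::complex_vector) \<Rightarrow> bool"
  where "clinear_on V f \<longleftrightarrow>
    (\<forall>x\<in>V. \<forall>y\<in>V. f (x + y) = f x + f y) \<and> (\<forall>c. \<forall>x\<in>V. f (c *\<^sub>C x) = c *\<^sub>C f x)"

lemma clinear_iff: "clinear f \<longleftrightarrow> (\<forall>x y. f (x + y) = f x + f y) \<and> (\<forall>c x. f (c *\<^sub>C x) = c *\<^sub>C f x)"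
  by (simp add: Vector_Spaces.linear_iff complex_vector.vector_space_axioms)

lemma clinearI:
  "(\<And>x y. f (x + y) = f x + f y) \<Longrightarrow> (\<And>c x. f (c *\<^sub>C x) = c *\<^sub>C f x) \<Longrightarrow> clinear f"
  by (simp add: clinear_iff)

lemma clinear_add: "clinear f \<Longrightarrow> f (x + y) = f x + f y"
  and clinear_scaleC: "clinear f \<Longrightarrow> f (c *\<^sub>C x) = c *\<^sub>C f x"
  by (simp_all add: clinear_iff)

lemma clinear_0: "clinear f \<Longrightarrow> f 0 = 0"
  using clinear_add[of f 0 0] by simp

lemma clinear_diff: "clinear f \<Longrightarrow> f (x - y) = f x - f y"
  using clinear_add[of f "x - y" y] by simp

lemma clinear_right: "cbilinear f \<Longrightarrow> clinear (f a)"
  and clinear_left: "cbilinear f \<Longrightarrow> clinear (\<lambda>a. f a b)"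
  by (simp_all add: cbilinear_def)

lemma clinear_span_eq:
  assumes "clinear f" "clinear g" "\<And>x. x \<in> B \<Longrightarrow> f x = g x" "x \<in> complex_vector.span B"
  shows "f x = g x"
  using assms(4)
proof (induct rule: complex_vector.span_induct_alt)
  case base then show ?case using assms(1,2) by (simp add: clinear_0)
next
  case (step c x y) then show ?case using assms by (simp add: clinear_add clinear_scaleC)
qed

lemma cbilinear_iff:
  "cbilinear f \<longleftrightarrow> (\<forall>a b b'. f a (b + b') = f a b + f a b') \<and> (\<forall>a c b. f a (c *\<^sub>C b) = c *\<^sub>C f a b)
    \<and> (\<forall>a a' b. f (a + a') b = f a b + f a' b) \<and> (\<forall>c a b. f (c *\<^sub>C a) b = c *\<^sub>C f a b)"
  unfolding cbilinear_def clinear_iff by blast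


section \<open>Free vector spaces\<close>

definition free_extend :: "('k \<Rightarrow> 'v::complex_vector) \<Rightarrow> ('k \<Rightarrow>\<^sub>0 complex) \<Rightarrow> 'v"
  where "free_extend g p = (\<Sum>k\<in>Poly_Mapping.keys p. Poly_Mapping.lookup p k *\<^sub>C g k)"

lemma free_extend_superset:
  assumes "finite K" "Poly_Mapping.keys p \<subseteq> K"
  shows "free_extend g p = (\<Sum>k\<in>K. Poly_Mapping.lookup p k *\<^sub>C g k)"
  unfolding free_extend_def
  by (rule sum.mono_neutral_left) (use assms in \<open>auto simp: in_keys_iff\<close>)

lemma clinear_free_extend: "clinear (free_extend g)"
proof (rule clinearI)
  fix p q :: "'a \<Rightarrow>\<^sub>0 complex" and c
  let ?K = "Poly_Mapping.keys p \<union> Poly_Mapping.keys q"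
  have "Poly_Mapping.keys (p + q) \<subseteq> ?K" by (rule keys_add)
  then show "free_extend g (p + q) = free_extend g p + free_extend g q"
    by (simp add: free_extend_superset[of ?K] lookup_add scaleC_add_left sum.distrib)
  have "Poly_Mapping.keys (c *\<^sub>C p) \<subseteq> Poly_Mapping.keys p" by (auto simp: in_keys_iff lookup_scaleC)
  then show "free_extend g (c *\<^sub>C p) = c *\<^sub>C free_extend g p"
    by (simp add: free_extend_superset[of "Poly_Mapping.keys p"] lookup_scaleC complex_vector.scale_sum_right
        scaleC_scaleC scaleC_complex_def)
qed

lemma free_extend_single: "free_extend g (Poly_Mapping.single k 1) = g k"
  by (simp add: free_extend_def scaleC_one)

lemma free_span: "complex_vector.span (range (\<lambda>k. Poly_Mapping.single k (1::complex))) = UNIV"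
proof -
  have "p \<in> complex_vector.span (range (\<lambda>k. Poly_Mapping.single k (1::complex)))"
    for p :: "'a \<Rightarrow>\<^sub>0 complex"
  proof -
    have "Poly_Mapping.lookup p j =
        Poly_Mapping.lookup (\<Sum>k\<in>Poly_Mapping.keys p.
          Poly_Mapping.lookup p k *\<^sub>C Poly_Mapping.single k (1::complex)) j" for j
      by (cases "j \<in> Poly_Mapping.keys p")
        (auto simp: lookup_sum lookup_scaleC lookup_single scaleC_complex_def when_def
          if_distrib sum.delta in_keys_iff cong: if_cong)
    then have eq: "p = (\<Sum>k\<in>Poly_Mapping.keys p.
        Poly_Mapping.lookup p k *\<^sub>C Poly_Mapping.single k (1::complex))"
      by (rule poly_mapping_eqI)
    show ?thesis
      by (subst eq, intro complex_vector.span_sum complex_vector.span_scale complex_vector.span_base)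
        simp
  qed
  then show ?thesis by blast
qed

lemma free_extend_span_cong:
  assumes "\<And>r. r \<in> R \<Longrightarrow> free_extend g r = 0" "p - q \<in> complex_vector.span R"
  shows "free_extend g p = free_extend g q"
proof -
  have "free_extend g (p - q) = 0"
    by (rule clinear_span_eq[OF clinear_free_extend _ assms(1) assms(2)]) (simp_all add: clinear_iff)
  then show ?thesis by (simp add: clinear_diff[OF clinear_free_extend])
qed

lemma span_diff_equivp: "equivp (\<lambda>p q. p - q \<in> complex_vector.span R)"
proof (rule equivpI)
  show "symp (\<lambda>p q. p - q \<in> complex_vector.span R)"
    by (rule sympI) (use complex_vector.span_neg in fastforce)
  show "transp (\<lambda>p q. p - q \<in> complex_vector.span R)"
    by (rule transpI) (use complex_vector.span_add in fastforce)
qed (simp add: reflp_def complex_vector.span_zero)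

lemma span_diff_add: 
  assumes "p - q \<in> complex_vector.span R" "p' - q' \<in> complex_vector.span R"
  shows "(p + p') - (q + q') \<in> complex_vector.span R"
  using complex_vector.span_add[OF assms] by (simp add: algebra_simps)

lemma span_diff_minus: 
  assumes "p - q \<in> complex_vector.span R" "p' - q' \<in> complex_vector.span R"
  shows "(p - p') - (q - q') \<in> complex_vector.span R"
  using complex_vector.span_diff[OF assms] by (simp add: algebra_simps)

lemma span_diff_uminus: 
  assumes "p - q \<in> complex_vector.span R"
  shows "(- p) - (- q) \<in> complex_vector.span R"
  using complex_vector.span_neg[OF assms] by (simp add: algebra_simps)

lemma span_diff_scaleC: 
  assumes "p - q \<in> complex_vector.span R"
  shows "c *\<^sub>C p - c *\<^sub>C q \<in> complex_vector.span R"
  using complex_vector.span_scale[OF assms, of c] by (simp add: complex_vector.scale_right_diff_distrib)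


section \<open>Tensor products\<close>

text \<open>\<open>A \<otimes> B\<close> is the free vector space on \<open>A \<times> B\<close> modulo the bilinearity relations.\<close>

definition tensor_relations :: "('a::complex_vector \<times> 'b::complex_vector \<Rightarrow>\<^sub>0 complex) set"
  where "tensor_relations =
    {Poly_Mapping.single (a + a', b) 1 - Poly_Mapping.single (a, b) 1
      - Poly_Mapping.single (a', b) 1 | a a' b. True} \<union>
    {Poly_Mapping.single (a, b + b') 1 - Poly_Mapping.single (a, b) 1
      - Poly_Mapping.single (a, b') 1 | a b b'. True} \<union>
    {Poly_Mapping.single (c *\<^sub>C a, b) 1 - c *\<^sub>C Poly_Mapping.single (a, b) 1 | c a b. True} \<union>
    {Poly_Mapping.single (a, c *\<^sub>C b) 1 - c *\<^sub>C Poly_Mapping.single (a, b) 1 | c a b. True}"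

quotient_type (overloaded) ('a, 'b) tensor (infixr \<open>\<otimes>\<close> 72) =
    "('a::complex_vector \<times> 'b::complex_vector) \<Rightarrow>\<^sub>0 complex"
  / "\<lambda>p q. p - q \<in> complex_vector.span tensor_relations"
  by (rule span_diff_equivp)

instantiation tensor :: (complex_vector, complex_vector) complex_vector
begin
lift_definition zero_tensor :: "'a \<otimes> 'b" is 0 .
lift_definition plus_tensor :: "'a \<otimes> 'b \<Rightarrow> 'a \<otimes> 'b \<Rightarrow> 'a \<otimes> 'b" is "(+)" by (rule span_diff_add)
lift_definition minus_tensor :: "'a \<otimes> 'b \<Rightarrow> 'a \<otimes> 'b \<Rightarrow> 'a \<otimes> 'b" is "(-)" by (rule span_diff_minus)
lift_definition uminus_tensor :: "'a \<otimes> 'b \<Rightarrow> 'a \<otimes> 'b" is uminus by (rule span_diff_uminus)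
lift_definition scaleC_tensor :: "complex \<Rightarrow> 'a \<otimes> 'b \<Rightarrow> 'a \<otimes> 'b" is scaleC by (rule span_diff_scaleC)
instance
  by standard (transfer, simp add: algebra_simps complex_vector.span_zero scaleC_add_right
      scaleC_add_left scaleC_scaleC scaleC_one)+
end

lift_definition tensor_pure :: "'a::complex_vector \<Rightarrow> 'b::complex_vector \<Rightarrow> 'a \<otimes> 'b"
    (infixr \<open>\<otimes>\<close> 72)
  is "\<lambda>a b. Poly_Mapping.single (a, b) 1" .

lemma cbilinear_tensor_pure: "cbilinear (\<otimes>)"
proof -
  have "x \<otimes> (y + y') = x \<otimes> y + x \<otimes> y'" for x :: 'a and y y' :: 'b
    by transfer (rule complex_vector.span_base, unfold tensor_relations_def diff_diff_eq[symmetric], blast)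
  moreover have "(x + x') \<otimes> y = x \<otimes> y + x' \<otimes> y" for x x' :: 'a and y :: 'b
    by transfer (rule complex_vector.span_base, unfold tensor_relations_def diff_diff_eq[symmetric], blast)
  moreover have "x \<otimes> c *\<^sub>C y = c *\<^sub>C (x \<otimes> y)" for x :: 'a and y :: 'b and c
    by transfer (rule complex_vector.span_base, unfold tensor_relations_def, blast)
  moreover have "(c *\<^sub>C x) \<otimes> y = c *\<^sub>C (x \<otimes> y)" for x :: 'a and y :: 'b and c
    by transfer (rule complex_vector.span_base, unfold tensor_relations_def, blast)
  ultimately show ?thesis unfolding cbilinear_iff by blast
qed


lemma tensor_span: "complex_vector.span {x \<otimes> y | x y. True} = UNIV"
proof -
  have lin: "clinear abs_tensor"
    by (rule clinearI) (simp_all add: plus_tensor.abs_eq scaleC_tensor.abs_eq)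
  have "abs_tensor p \<in> complex_vector.span {x \<otimes> y | x y. True}"
    for p :: "'a \<times> 'b \<Rightarrow>\<^sub>0 complex"
  proof -
    have "p \<in> complex_vector.span (range (\<lambda>k. Poly_Mapping.single k (1::complex)))"
      by (simp add: free_span)
    then show ?thesis
    proof (induct rule: complex_vector.span_induct_alt)
      case base then show ?case by (simp add: clinear_0[OF lin] complex_vector.span_zero)
    next
      case (step c q r)
      then obtain a b where "q = Poly_Mapping.single (a, b) 1" by auto
      then have "abs_tensor q = a \<otimes> b" by (simp add: tensor_pure.abs_eq)
      then show ?case using step(2)
        unfolding clinear_add[OF lin] clinear_scaleC[OF lin]
        by (intro complex_vector.span_add complex_vector.span_scale)
          (auto intro: complex_vector.span_base)
    qed
  qed
  then have "x \<in> complex_vector.span {x \<otimes> y | x y. True}" for x :: "'a \<otimes> 'b"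
    by (induct x rule: tensor.abs_induct) blast
  then show ?thesis by blast
qed

lemma tensor_eqI:
  assumes "clinear F" "clinear G" "\<And>a b. F (a \<otimes> b) = G (a \<otimes> b)"
  shows "F = G"
  by (rule ext, rule clinear_span_eq[OF assms(1,2), of "{x \<otimes> y | x y. True}"])
    (use assms(3) tensor_span in auto)

text \<open>The linear map on the tensor product induced by a bilinear map.\<close>

definition tensor_lift ::
    "('a::complex_vector \<Rightarrow> 'b::complex_vector \<Rightarrow> 'c::complex_vector) \<Rightarrow> 'a \<otimes> 'b \<Rightarrow> 'c"
  where "tensor_lift f = (THE F. clinear F \<and> (\<forall>a b. F (a \<otimes> b) = f a b))"

lemma tensor_lift_ex:
  assumes "cbilinear f"
  shows "\<exists>F. clinear F \<and> (\<forall>a b. F (a \<otimes> b) = f a b)"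
proof -
  let ?g = "\<lambda>(a, b). f a b"
  note fe = clinear_free_extend[of ?g]
  have 0: "free_extend ?g r = 0" if "r \<in> tensor_relations" for r
    using that assms unfolding tensor_relations_def cbilinear_iff
    by (auto simp: clinear_diff[OF fe] clinear_scaleC[OF fe] free_extend_single)
  have resp: "free_extend ?g (rep_tensor (abs_tensor p)) = free_extend ?g p" for p
    by (rule free_extend_span_cong[OF 0 Quotient3_rep_abs[OF Quotient3_tensor]])
      (simp_all add: complex_vector.span_zero)
  let ?F = "\<lambda>t. free_extend ?g (rep_tensor t)"
  have "clinear ?F"
  proof (rule clinearI)
    show "?F (x + y) = ?F x + ?F y" for x y
      by (induct x rule: tensor.abs_induct, induct y rule: tensor.abs_induct)
        (simp add: resp plus_tensor.abs_eq clinear_add[OF fe])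
    show "?F (c *\<^sub>C x) = c *\<^sub>C ?F x" for c x
      by (induct x rule: tensor.abs_induct) (simp add: resp scaleC_tensor.abs_eq clinear_scaleC[OF fe])
  qed
  moreover have "?F (a \<otimes> b) = f a b" for a b
    by (simp add: tensor_pure.abs_eq resp free_extend_single)
  ultimately show ?thesis by blast
qed

lemma
  assumes "cbilinear f"
  shows clinear_tensor_lift: "clinear (tensor_lift f)"
    and tensor_lift_pure: "tensor_lift f (a \<otimes> b) = f a b"
proof -
  have "\<exists>!F. clinear F \<and> (\<forall>a b. F (a \<otimes> b) = f a b)"
    using tensor_lift_ex[OF assms] by (metis tensor_eqI)
  from theI'[OF this] show "clinear (tensor_lift f)" "tensor_lift f (a \<otimes> b) = f a b"
    unfolding tensor_lift_def by blast+
qed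

text \<open>Sweedler sums: for \<open>t = \<Sum>\<^sub>i x\<^sub>i \<otimes> y\<^sub>i\<close> and bilinear \<open>f\<close>, \<open>sweedler t f\<close> is
  \<open>\<Sum>\<^sub>i f x\<^sub>i y\<^sub>i\<close>.\<close>

abbreviation sweedler ::
    "'a \<otimes> 'b \<Rightarrow> ('a::complex_vector \<Rightarrow> 'b::complex_vector \<Rightarrow> 'c::complex_vector) \<Rightarrow> 'c"
  where "sweedler t f \<equiv> tensor_lift f t"


section \<open>Tensor powers\<close>

text \<open>The tensor algebra \<open>T(A)\<close> is the free vector space on the words over \<open>A\<close> modulo
  multilinearity in each letter; \<open>A\<^bsup>\<otimes>n\<^esup>\<close> is its homogeneous component of degree \<open>n\<close>. In this
  way \<open>n\<close> remains an ordinary variable, although all tensor powers live in one type.\<close>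

definition multilinear_relations :: "('a::complex_vector list \<Rightarrow>\<^sub>0 complex) set"
  where "multilinear_relations =
    {Poly_Mapping.single (xs @ (a + b) # ys) 1 - Poly_Mapping.single (xs @ a # ys) 1
      - Poly_Mapping.single (xs @ b # ys) 1 | xs a b ys. True} \<union>
    {Poly_Mapping.single (xs @ (c *\<^sub>C a) # ys) 1 - c *\<^sub>C Poly_Mapping.single (xs @ a # ys) 1
      | xs c a ys. True}"

quotient_type (overloaded) 'a tensor_algebra = "'a::complex_vector list \<Rightarrow>\<^sub>0 complex"
  / "\<lambda>p q. p - q \<in> complex_vector.span multilinear_relations"
  by (rule span_diff_equivp)

instantiation tensor_algebra :: (complex_vector) complex_vector
begin
lift_definition zero_tensor_algebra :: "'a tensor_algebra" is 0 .
lift_definition plus_tensor_algebra ::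
  "'a tensor_algebra \<Rightarrow> 'a tensor_algebra \<Rightarrow> 'a tensor_algebra" is "(+)" by (rule span_diff_add)
lift_definition minus_tensor_algebra ::
  "'a tensor_algebra \<Rightarrow> 'a tensor_algebra \<Rightarrow> 'a tensor_algebra" is "(-)" by (rule span_diff_minus)
lift_definition uminus_tensor_algebra ::
  "'a tensor_algebra \<Rightarrow> 'a tensor_algebra" is uminus by (rule span_diff_uminus)
lift_definition scaleC_tensor_algebra ::
  "complex \<Rightarrow> 'a tensor_algebra \<Rightarrow> 'a tensor_algebra" is scaleC by (rule span_diff_scaleC)
instance
  by standard (transfer, simp add: algebra_simps complex_vector.span_zero scaleC_add_right
      scaleC_add_left scaleC_scaleC scaleC_one)+
end

text \<open>\<open>pure_tensor [a\<^sub>1, \<dots>, a\<^sub>n]\<close> is \<open>a\<^sub>1 \<otimes> \<dots> \<otimes> a\<^sub>n\<close>.\<close>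

lift_definition pure_tensor :: "'a::complex_vector list \<Rightarrow> 'a tensor_algebra"
  is "\<lambda>as. Poly_Mapping.single as 1" .

definition tensor_power :: "nat \<Rightarrow> 'a::complex_vector tensor_algebra set"
  where "tensor_power n = complex_vector.span {pure_tensor as | as. length as = n}"

definition multilinear :: "('a::complex_vector list \<Rightarrow> 'b::complex_vector) \<Rightarrow> bool"
  where "multilinear g \<longleftrightarrow> (\<forall>xs ys. clinear (\<lambda>a. g (xs @ a # ys)))"

definition multi_lift :: "('a::complex_vector list \<Rightarrow> 'b::complex_vector) \<Rightarrow> 'a tensor_algebra \<Rightarrow> 'b"
  where "multi_lift g = (THE F. clinear F \<and> (\<forall>as. F (pure_tensor as) = g as))"

lemma multilinear_pure_tensor: "multilinear pure_tensor"
proof -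
  have "pure_tensor (xs @ (a + b) # ys) = pure_tensor (xs @ a # ys) + pure_tensor (xs @ b # ys)"
    for xs ys and a b :: 'a
    by transfer (rule complex_vector.span_base, unfold multilinear_relations_def diff_diff_eq[symmetric], blast)
  moreover have "pure_tensor (xs @ (c *\<^sub>C a) # ys) = c *\<^sub>C pure_tensor (xs @ a # ys)"
    for xs ys and a :: 'a and c
    by transfer (rule complex_vector.span_base, unfold multilinear_relations_def, blast)
  ultimately show ?thesis unfolding multilinear_def clinear_iff by blast
qed

lemma pure_tensor_span: "complex_vector.span (range pure_tensor) = UNIV"
proof -
  have lin: "clinear abs_tensor_algebra"
    by (rule clinearI) (simp_all add: plus_tensor_algebra.abs_eq scaleC_tensor_algebra.abs_eq)
  have "abs_tensor_algebra p \<in> complex_vector.span (range pure_tensor)"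
    for p :: "'a list \<Rightarrow>\<^sub>0 complex"
  proof -
    have "p \<in> complex_vector.span (range (\<lambda>k. Poly_Mapping.single k (1::complex)))"
      by (simp add: free_span)
    then show ?thesis
    proof (induct rule: complex_vector.span_induct_alt)
      case base then show ?case by (simp add: clinear_0[OF lin] complex_vector.span_zero)
    next
      case (step c q r)
      then obtain as where "q = Poly_Mapping.single as 1" by auto
      then have "abs_tensor_algebra q = pure_tensor as" by (simp add: pure_tensor.abs_eq)
      then show ?case using step(2)
        unfolding clinear_add[OF lin] clinear_scaleC[OF lin]
        by (intro complex_vector.span_add complex_vector.span_scale)
          (auto intro: complex_vector.span_base)
    qed
  qed
  then have "x \<in> complex_vector.span (range pure_tensor)" for x :: "'a tensor_algebra"
    by (induct x rule: tensor_algebra.abs_induct) blast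
  then show ?thesis by blast
qed

lemma tensor_algebra_eqI:
  assumes "clinear F" "clinear G" "\<And>as. F (pure_tensor as) = G (pure_tensor as)"
  shows "F = G"
  by (rule ext, rule clinear_span_eq[OF assms(1,2), of "range pure_tensor"])
    (use assms(3) pure_tensor_span in auto)

lemma multi_lift_ex:
  assumes "multilinear g"
  shows "\<exists>F. clinear F \<and> (\<forall>as. F (pure_tensor as) = g as)"
proof -
  note fe = clinear_free_extend[of g]
  have 0: "free_extend g r = 0" if "r \<in> multilinear_relations" for r
    using that assms unfolding multilinear_relations_def multilinear_def clinear_iff
    by (auto simp: clinear_diff[OF fe] clinear_scaleC[OF fe] free_extend_single)
  have resp: "free_extend g (rep_tensor_algebra (abs_tensor_algebra p)) = free_extend g p" for p
    by (rule free_extend_span_cong[OF 0 Quotient3_rep_abs[OF Quotient3_tensor_algebra]])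
      (simp_all add: complex_vector.span_zero)
  let ?F = "\<lambda>t. free_extend g (rep_tensor_algebra t)"
  have "clinear ?F"
  proof (rule clinearI)
    show "?F (x + y) = ?F x + ?F y" for x y
      by (induct x rule: tensor_algebra.abs_induct, induct y rule: tensor_algebra.abs_induct)
        (simp add: resp plus_tensor_algebra.abs_eq clinear_add[OF fe])
    show "?F (c *\<^sub>C x) = c *\<^sub>C ?F x" for c x
      by (induct x rule: tensor_algebra.abs_induct)
        (simp add: resp scaleC_tensor_algebra.abs_eq clinear_scaleC[OF fe])
  qed
  moreover have "?F (pure_tensor as) = g as" for as
    by (simp add: pure_tensor.abs_eq resp free_extend_single)
  ultimately show ?thesis by blast
qed

lemma
  assumes "multilinear g"
  shows clinear_multi_lift: "clinear (multi_lift g)"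
    and multi_lift_pure: "multi_lift g (pure_tensor as) = g as"
proof -
  have "\<exists>!F. clinear F \<and> (\<forall>as. F (pure_tensor as) = g as)"
    using multi_lift_ex[OF assms] by (metis tensor_algebra_eqI)
  from theI'[OF this] show "clinear (multi_lift g)" "multi_lift g (pure_tensor as) = g as"
    unfolding multi_lift_def by blast+
qed

definition tensor_cons :: "'a::complex_vector \<Rightarrow> 'a tensor_algebra \<Rightarrow> 'a tensor_algebra"
  where "tensor_cons a = multi_lift (\<lambda>as. pure_tensor (a # as))"


lemma clinear_slot:
  "multilinear g \<Longrightarrow> clinear (\<lambda>a. g (a # as))"
  unfolding multilinear_def by (drule spec[of _ "[]"]) simp

lemma multilinear_cons: "multilinear g \<Longrightarrow> multilinear (\<lambda>as. g (a # as))"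
  unfolding multilinear_def append_Cons[symmetric] by blast

lemma tensor_cons_pure: "tensor_cons a (pure_tensor as) = pure_tensor (a # as)"
  unfolding tensor_cons_def
  by (rule multi_lift_pure) (rule multilinear_cons[OF multilinear_pure_tensor])

lemma cbilinear_tensor_cons: "cbilinear tensor_cons"
proof -
  have 1: "clinear (tensor_cons a)" for a :: 'a
    unfolding tensor_cons_def
    by (rule clinear_multi_lift) (rule multilinear_cons[OF multilinear_pure_tensor])
  note slot = clinear_slot[OF multilinear_pure_tensor]
  have 2: "tensor_cons (a + b) = (\<lambda>x. tensor_cons a x + tensor_cons b x)" for a b :: 'a
    by (rule tensor_algebra_eqI[OF 1])
      (auto intro!: clinearI simp: clinear_add[OF 1] clinear_scaleC[OF 1] tensor_cons_pure
        clinear_add[OF slot] scaleC_add_right algebra_simps)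
  have 3: "tensor_cons (c *\<^sub>C a) = (\<lambda>x. c *\<^sub>C tensor_cons a x)" for c and a :: 'a
    by (rule tensor_algebra_eqI[OF 1])
      (auto intro!: clinearI simp: clinear_add[OF 1] clinear_scaleC[OF 1] tensor_cons_pure
        clinear_scaleC[OF slot] scaleC_add_right scaleC_scaleC mult.commute)
  show ?thesis
    unfolding cbilinear_def using 1 by (auto intro!: clinearI simp: 2 3)
qed

lemma clinear_comp: "clinear f \<Longrightarrow> clinear g \<Longrightarrow> clinear (\<lambda>x. f (g x))"
  by (simp add: clinear_iff)

lemma cbilinear_comp:
  "cbilinear f \<Longrightarrow> clinear g \<Longrightarrow> clinear h \<Longrightarrow> cbilinear (\<lambda>x y. f (g x) (h y))"
  by (simp add: clinear_iff cbilinear_iff)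

text \<open>Linearity of a Sweedler sum in a parameter of the summand.\<close>

lemma clinear_sweedler_param:
  assumes bil: "\<And>x. cbilinear (f x)" and lin: "\<And>y z. clinear (\<lambda>x. f x y z)"
  shows "clinear (\<lambda>x. sweedler t (f x))"
proof (rule clinearI)
  note L = clinear_tensor_lift[OF bil] and P = tensor_lift_pure[OF bil]
  have "tensor_lift (f (x + y)) = (\<lambda>t. sweedler t (f x) + sweedler t (f y))" for x y
    by (rule tensor_eqI[OF L])
      (auto intro!: clinearI simp: clinear_add[OF L] clinear_scaleC[OF L] P clinear_add[OF lin]
        scaleC_add_right algebra_simps)
  then show "sweedler t (f (x + y)) = sweedler t (f x) + sweedler t (f y)" for x y by simp
  have "tensor_lift (f (c *\<^sub>C x)) = (\<lambda>t. c *\<^sub>C sweedler t (f x))" for c x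
    by (rule tensor_eqI[OF L])
      (auto intro!: clinearI simp: clinear_add[OF L] clinear_scaleC[OF L] P clinear_scaleC[OF lin]
        scaleC_add_right scaleC_scaleC mult.commute)
  then show "sweedler t (f (c *\<^sub>C x)) = c *\<^sub>C sweedler t (f x)" for c x by simp
qed


section \<open>Cocyclic modules\<close>

text \<open>\<open>d n i\<close> is the coface from degree \<open>n - 1\<close> to degree \<open>n\<close>, \<open>s n i\<close> the codegeneracy from
  degree \<open>n + 1\<close> to degree \<open>n\<close>, and \<open>t n\<close> the cyclic operator in degree \<open>n\<close>.\<close>

locale cosimplicial_module =
  fixes C :: "nat \<Rightarrow> 'v::complex_vector set"
    and d s :: "nat \<Rightarrow> nat \<Rightarrow> 'v \<Rightarrow> 'v"
  assumes subspace: "complex_vector.subspace (C n)"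
    and d_maps: "n \<ge> 1 \<Longrightarrow> i \<le> n \<Longrightarrow> f \<in> C (n - 1) \<Longrightarrow> d n i f \<in> C n"
    and d_linear: "n \<ge> 1 \<Longrightarrow> i \<le> n \<Longrightarrow> clinear_on (C (n - 1)) (d n i)"
    and s_maps: "i \<le> n \<Longrightarrow> f \<in> C (n + 1) \<Longrightarrow> s n i f \<in> C n"
    and s_linear: "i \<le> n \<Longrightarrow> clinear_on (C (n + 1)) (s n i)"
    and d_d: "n \<ge> 1 \<Longrightarrow> i < j \<Longrightarrow> j \<le> n + 1 \<Longrightarrow> f \<in> C (n - 1) \<Longrightarrow>
      d (n + 1) j (d n i f) = d (n + 1) i (d n (j - 1) f)"
    and s_s: "i \<le> j \<Longrightarrow> j \<le> n \<Longrightarrow> f \<in> C (n + 2) \<Longrightarrow>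
      s n j (s (n + 1) i f) = s n i (s (n + 1) (j + 1) f)"
    and s_d_less: "i < j \<Longrightarrow> j \<le> n \<Longrightarrow> f \<in> C n \<Longrightarrow>
      s n j (d (n + 1) i f) = d n i (s (n - 1) (j - 1) f)"
    and s_d_eq: "i = j \<or> i = j + 1 \<Longrightarrow> j \<le> n \<Longrightarrow> f \<in> C n \<Longrightarrow> s n j (d (n + 1) i f) = f"
    and s_d_greater: "j + 1 < i \<Longrightarrow> i \<le> n + 1 \<Longrightarrow> f \<in> C n \<Longrightarrow>
      s n j (d (n + 1) i f) = d n (i - 1) (s (n - 1) j f)"

locale cocyclic_module = cosimplicial_module C d s
  for C :: "nat \<Rightarrow> 'v::complex_vector set" and d s +
  fixes t :: "nat \<Rightarrow> 'v \<Rightarrow> 'v"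
  assumes t_maps: "f \<in> C n \<Longrightarrow> t n f \<in> C n"
    and t_linear: "clinear_on (C n) (t n)"
    and t_d: "1 \<le> i \<Longrightarrow> i \<le> n \<Longrightarrow> f \<in> C (n - 1) \<Longrightarrow> t n (d n i f) = d n (i - 1) (t (n - 1) f)"
    and t_d_0: "n \<ge> 1 \<Longrightarrow> f \<in> C (n - 1) \<Longrightarrow> t n (d n 0 f) = d n n f"
    and t_s: "1 \<le> i \<Longrightarrow> i \<le> n \<Longrightarrow> f \<in> C (n + 1) \<Longrightarrow>
      t n (s n i f) = s n (i - 1) (t (n + 1) f)"
    and t_s_0: "f \<in> C (n + 1) \<Longrightarrow> t n (s n 0 f) = s n n (t (n + 1) (t (n + 1) f))"
    and t_cyclic: "f \<in> C n \<Longrightarrow> (t n ^^ (n + 1)) f = f"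


section \<open>Hopf algebras, module algebras and module-comodules\<close>

locale hopf_algebra =
  fixes \<Delta> :: "'h::complex_unital_algebra \<Rightarrow> 'h \<otimes> 'h"
    and \<epsilon> :: "'h \<Rightarrow> complex"
    and S :: "'h \<Rightarrow> 'h"
  assumes \<Delta>_linear: "clinear \<Delta>"
    and \<epsilon>_linear: "clinear \<epsilon>"
    and S_linear: "clinear S"
    and coassoc: "sweedler (\<Delta> h) (\<lambda>x y. sweedler (\<Delta> x) (\<lambda>x1 x2. x1 \<otimes> x2 \<otimes> y))
      = sweedler (\<Delta> h) (\<lambda>x y. x \<otimes> \<Delta> y)"
    and counit_left: "sweedler (\<Delta> h) (\<lambda>x y. \<epsilon> x *\<^sub>C y) = h"
    and counit_right: "sweedler (\<Delta> h) (\<lambda>x y. \<epsilon> y *\<^sub>C x) = h"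
    and \<Delta>_mult: "\<Delta> (h * k) =
      sweedler (\<Delta> h) (\<lambda>h1 h2. sweedler (\<Delta> k) (\<lambda>k1 k2. (h1 * k1) \<otimes> (h2 * k2)))"
    and \<Delta>_one: "\<Delta> 1 = 1 \<otimes> 1"
    and \<epsilon>_mult: "\<epsilon> (h * k) = \<epsilon> h * \<epsilon> k"
    and \<epsilon>_one: "\<epsilon> 1 = 1"
    and antipode_left: "sweedler (\<Delta> h) (\<lambda>x y. S x * y) = \<epsilon> h *\<^sub>C 1"
    and antipode_right: "sweedler (\<Delta> h) (\<lambda>x y. x * S y) = \<epsilon> h *\<^sub>C 1"

locale left_module_algebra = hopf_algebra \<Delta> \<epsilon> S
  for \<Delta> :: "'h::complex_unital_algebra \<Rightarrow> 'h \<otimes> 'h" and \<epsilon> S +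
  fixes act :: "'h \<Rightarrow> 'a::complex_unital_algebra \<Rightarrow> 'a"  (infixr \<open>\<rhd>\<close> 75)
  assumes act_bilinear: "cbilinear (\<rhd>)"
    and act_one: "1 \<rhd> a = a"
    and act_mult: "(h * k) \<rhd> a = h \<rhd> k \<rhd> a"
    and act_prod: "h \<rhd> (a * b) = sweedler (\<Delta> h) (\<lambda>h1 h2. (h1 \<rhd> a) * (h2 \<rhd> b))"
    and act_unit: "h \<rhd> 1 = \<epsilon> h *\<^sub>C 1"
begin

text \<open>The diagonal action of \<open>H\<close> on words, and its linear extension to \<open>T(A)\<close>.\<close>

primrec diag_list :: "'h \<Rightarrow> 'a list \<Rightarrow> 'a tensor_algebra"
  where
    "diag_list h [] = \<epsilon> h *\<^sub>C pure_tensor []"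
  | "diag_list h (a # as) =
      sweedler (\<Delta> h) (\<lambda>h1 h2. tensor_cons (h1 \<rhd> a) (diag_list h2 as))"

definition diag :: "'h \<Rightarrow> 'a tensor_algebra \<Rightarrow> 'a tensor_algebra"
  where "diag h = multi_lift (diag_list h)"

lemma clinear_diag_list: "clinear (\<lambda>h. diag_list h as)"
proof (induct as)
  case Nil
  then show ?case by (auto intro!: clinearI simp: clinear_add[OF \<epsilon>_linear]
        clinear_scaleC[OF \<epsilon>_linear] scaleC_add_left scaleC_scaleC scaleC_complex_def)
next
  case (Cons a as)
  have "clinear (\<lambda>h. h \<rhd> a)" using act_bilinear by (simp add: cbilinear_def)
  then have "cbilinear (\<lambda>h1 h2. tensor_cons (h1 \<rhd> a) (diag_list h2 as))"
    using cbilinear_comp[OF cbilinear_tensor_cons _ Cons] by blast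
  then show ?case
    using clinear_comp[OF clinear_tensor_lift \<Delta>_linear] by simp
qed

lemma multilinear_diag_list: "multilinear (diag_list h)"
proof -
  have act: "clinear ((\<rhd>) h)" "clinear (\<lambda>h. h \<rhd> a)" for h a
    using act_bilinear by (simp_all add: cbilinear_def)
  note bil = cbilinear_comp[OF cbilinear_tensor_cons act(2) clinear_diag_list]
  have tc: "clinear (tensor_cons a)" "clinear (\<lambda>a. tensor_cons a x)" for a :: 'a and x
    by (rule clinear_right[OF cbilinear_tensor_cons], rule clinear_left[OF cbilinear_tensor_cons])
  have "clinear (\<lambda>a. diag_list h (xs @ a # ys))" for xs ys
  proof (induct xs arbitrary: h)
    case Nil
    show ?case
      using clinear_sweedler_param[OF bil clinear_comp[OF tc(2) act(1)]] by simp
  next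
    case (Cons x xs)
    show ?case
      using clinear_sweedler_param[OF bil clinear_comp[OF tc(1) Cons]] by simp
  qed
  then show ?thesis by (simp add: multilinear_def)
qed

lemma diag_pure: "diag h (pure_tensor as) = diag_list h as"
  unfolding diag_def by (rule multi_lift_pure) (rule multilinear_diag_list)

end

locale right_left_module_comodule = hopf_algebra \<Delta> \<epsilon> S
  for \<Delta> :: "'h::complex_unital_algebra \<Rightarrow> 'h \<otimes> 'h" and \<epsilon> S +
  fixes ract :: "'m::complex_vector \<Rightarrow> 'h \<Rightarrow> 'm"  (infixl \<open>\<lhd>\<close> 75)
    and \<rho> :: "'m \<Rightarrow> 'h \<otimes> 'm"
  assumes ract_bilinear: "cbilinear (\<lhd>)"
    and ract_one: "m \<lhd> 1 = m"
    and ract_mult: "m \<lhd> (h * k) = m \<lhd> h \<lhd> k"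
    and \<rho>_linear: "clinear \<rho>"
    and \<rho>_coassoc: "sweedler (\<rho> m) (\<lambda>h m'. sweedler (\<Delta> h) (\<lambda>h1 h2. h1 \<otimes> h2 \<otimes> m'))
      = sweedler (\<rho> m) (\<lambda>h m'. h \<otimes> \<rho> m')"
    and \<rho>_counit: "sweedler (\<rho> m) (\<lambda>h m'. \<epsilon> h *\<^sub>C m') = m"


section \<open>The cochain spaces and their operators\<close>

text \<open>\<open>Hom(V, \<complex>)\<close>. A functional on the subspace \<open>V\<close> is represented by the function that agrees
  with it on \<open>V\<close> and is \<open>0\<close> outside \<open>V\<close>, so that equal functionals are equal functions.\<close>

definition functionals :: "'v::complex_vector set \<Rightarrow> ('v \<Rightarrow> complex) set"
  where "functionals V = {f. clinear_on V f \<and> (\<forall>x. x \<notin> V \<longrightarrow> f x = 0)}"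

text \<open>\<open>M \<otimes> A\<^bsup>\<otimes>(n+1)\<^esup>\<close>\<close>

definition coeff_tensor :: "nat \<Rightarrow> ('m::complex_vector \<otimes> 'a::complex_vector tensor_algebra) set"
  where "coeff_tensor n = complex_vector.span {m \<otimes> x | m x. x \<in> tensor_power (n + 1)}"

text \<open>The functional on \<open>M \<otimes> A\<^bsup>\<otimes>(n+1)\<^esup>\<close> with prescribed values on the tensors
  \<open>m \<otimes> a\<^sub>0 \<otimes> \<dots> \<otimes> a\<^sub>n\<close>.\<close>

definition functional_of :: "nat \<Rightarrow> ('m::complex_vector \<Rightarrow> 'a::complex_vector list \<Rightarrow> complex) \<Rightarrow>
    'm \<otimes> 'a tensor_algebra \<Rightarrow> complex"
  where "functional_of n g = (THE f. f \<in> functionals (coeff_tensor n) \<and>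
    (\<forall>m as. length as = n + 1 \<longrightarrow> f (m \<otimes> pure_tensor as) = g m as))"

lemma pure_in_coeff_tensor: "length as = n + 1 \<Longrightarrow> m \<otimes> pure_tensor as \<in> coeff_tensor n"
  unfolding coeff_tensor_def tensor_power_def by (blast intro: complex_vector.span_base)

lemma coeff_tensor_span:
  "coeff_tensor n = complex_vector.span {m \<otimes> pure_tensor as | m as. length as = n + 1}"
    (is "_ = complex_vector.span ?B")
proof
  have lin: "clinear ((\<otimes>) m)" for m :: 'a
    by (rule clinear_right[OF cbilinear_tensor_pure])
  have "m \<otimes> x \<in> complex_vector.span ?B" if "x \<in> tensor_power (n + 1)" for m x
    using that unfolding tensor_power_def
  proof (induct rule: complex_vector.span_induct_alt)
    case base then show ?case by (simp add: clinear_0[OF lin] complex_vector.span_zero)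
  next
    case (step c x y) then show ?case
      by (auto simp: clinear_add[OF lin] clinear_scaleC[OF lin]
            intro!: complex_vector.span_add complex_vector.span_scale intro: complex_vector.span_base)
  qed
  then show "coeff_tensor n \<subseteq> complex_vector.span ?B"
    unfolding coeff_tensor_def by (intro complex_vector.span_minimal) auto
  have "?B \<subseteq> coeff_tensor n" using pure_in_coeff_tensor by blast
  then show "complex_vector.span ?B \<subseteq> coeff_tensor n"
    by (intro complex_vector.span_minimal) (auto simp: coeff_tensor_def)
qed

lemma functionals_eqI:
  assumes f: "f \<in> functionals (coeff_tensor n)" and g: "g \<in> functionals (coeff_tensor n)"
    and eq: "\<And>m as. length as = n + 1 \<Longrightarrow> f (m \<otimes> pure_tensor as) = g (m \<otimes> pure_tensor as)"
  shows "f = g"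
proof
  fix x
  show "f x = g x"
  proof (cases "x \<in> coeff_tensor n")
    case False then show ?thesis using f g by (simp add: functionals_def)
  next
    case True
    let ?B = "{m \<otimes> pure_tensor as | (m::'a) as. length as = n + 1}"
    have z: "h 0 = 0" if "h \<in> functionals (coeff_tensor n)"
      for h :: "'a \<otimes> 'b tensor_algebra \<Rightarrow> complex"
    proof -
      have "h (0 + 0) = h 0 + h 0"
        using that complex_vector.span_zero[of "{m \<otimes> x | (m::'a) x. x \<in> tensor_power (n + 1)}"]
        unfolding functionals_def clinear_on_def coeff_tensor_def by blast
      then show ?thesis by simp
    qed
    note 0 = z[OF f] z[OF g]
    from True have "x \<in> complex_vector.span ?B" by (simp add: coeff_tensor_span)
    then have "x \<in> coeff_tensor n \<and> f x = g x"
    proof (induct rule: complex_vector.span_induct_alt)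
      case base then show ?case
        using 0 by (simp add: coeff_tensor_def complex_vector.span_zero)
    next
      case (step c y z)
      then have "y \<in> coeff_tensor n" "f y = g y" using pure_in_coeff_tensor eq by blast+
      moreover from this have "c *\<^sub>C y \<in> coeff_tensor n"
        by (simp add: coeff_tensor_def complex_vector.span_scale)
      moreover from this step have "c *\<^sub>C y + z \<in> coeff_tensor n"
        by (simp add: coeff_tensor_def complex_vector.span_add)
      moreover note \<open>z \<in> coeff_tensor n \<and> f z = g z\<close>
      moreover have "f (c *\<^sub>C y + z) = c *\<^sub>C f y + f z" "g (c *\<^sub>C y + z) = c *\<^sub>C g y + g z"
        using f g calculation unfolding functionals_def clinear_on_def by auto
      ultimately show ?case by simp
    qed
    then show ?thesis by blast
  qed
qed

lemma
  assumes 1: "\<And>as. length as = n + 1 \<Longrightarrow> clinear (\<lambda>m. g m as)"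
    and 2: "\<And>m xs ys. length xs + length ys = n \<Longrightarrow> clinear (\<lambda>a. g m (xs @ a # ys))"
  shows functional_of_in: "functional_of n g \<in> functionals (coeff_tensor n)"
    and functional_of_pure:
      "length as = n + 1 \<Longrightarrow> functional_of n g (m \<otimes> pure_tensor as) = g m as"
proof -
  let ?g = "\<lambda>m as. if length as = Suc n then g m as else 0"
  let ?G = "tensor_lift (\<lambda>m. multi_lift (?g m))"
  let ?F = "\<lambda>x. if x \<in> coeff_tensor n then ?G x else 0"
  have mul: "multilinear (?g m)" for m
    unfolding multilinear_def using 2 by (auto simp: clinear_iff)
  note L = clinear_multi_lift[OF mul] and P = multi_lift_pure[OF mul]
  have add: "multi_lift (?g (m + m')) = (\<lambda>x. multi_lift (?g m) x + multi_lift (?g m') x)" for m m'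
    by (rule tensor_algebra_eqI[OF L])
      (auto intro!: clinearI simp: P clinear_add[OF L] clinear_scaleC[OF L] scaleC_add_right
        clinear_add[OF 1] algebra_simps)
  have scale: "multi_lift (?g (c *\<^sub>C m)) = (\<lambda>x. c *\<^sub>C multi_lift (?g m) x)" for c m
    by (rule tensor_algebra_eqI[OF L])
      (auto intro!: clinearI simp: P clinear_add[OF L] clinear_scaleC[OF L] scaleC_add_right
        clinear_scaleC[OF 1] scaleC_scaleC mult.commute)
  have bil: "cbilinear (\<lambda>m. multi_lift (?g m))"
    unfolding cbilinear_def using L by (auto intro!: clinearI simp: add scale)
  note LG = clinear_tensor_lift[OF bil]
  have "?F \<in> functionals (coeff_tensor n)"
    by (auto simp: functionals_def clinear_on_def clinear_add[OF LG] clinear_scaleC[OF LG]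
        coeff_tensor_def complex_vector.span_add complex_vector.span_scale)
  moreover have "\<forall>m as. length as = n + 1 \<longrightarrow> ?F (m \<otimes> pure_tensor as) = g m as"
    by (simp add: pure_in_coeff_tensor tensor_lift_pure[OF bil] P)
  ultimately have "\<exists>!f. f \<in> functionals (coeff_tensor n) \<and>
      (\<forall>m as. length as = n + 1 \<longrightarrow> f (m \<otimes> pure_tensor as) = g m as)"
    by (intro ex1I[of _ ?F] conjI functionals_eqI[of _ n]) simp_all
  from theI'[OF this] show "functional_of n g \<in> functionals (coeff_tensor n)"
    "length as = n + 1 \<Longrightarrow> functional_of n g (m \<otimes> pure_tensor as) = g m as"
    unfolding functional_of_def by blast+
qed

locale AH_module_comodule = left_module_algebra \<Delta> \<epsilon> S act + right_left_module_comodule \<Delta> \<epsilon> S ract \<rho>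
  for \<Delta> :: "'h::complex_unital_algebra \<Rightarrow> 'h \<otimes> 'h" and \<epsilon> S
    and act :: "'h \<Rightarrow> 'a::complex_unital_algebra \<Rightarrow> 'a"  (infixr \<open>\<rhd>\<close> 75)
    and ract :: "'m::complex_vector \<Rightarrow> 'h \<Rightarrow> 'm"  (infixl \<open>\<lhd>\<close> 75)
    and \<rho> :: "'m \<Rightarrow> 'h \<otimes> 'm"
begin

text \<open>Meaningful only if \<open>S\<close> is bijective.\<close>

abbreviation S_inv :: "'h \<Rightarrow> 'h"
  where "S_inv \<equiv> inv S"

definition tensor_ract :: "'m \<otimes> 'a tensor_algebra \<Rightarrow> 'h \<Rightarrow> 'm \<otimes> 'a tensor_algebra"
  where "tensor_ract x h =
    sweedler x (\<lambda>m y. sweedler (\<Delta> h) (\<lambda>h1 h2. (m \<lhd> h1) \<otimes> diag (S h2) y))"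

definition cochains :: "nat \<Rightarrow> ('m \<otimes> 'a tensor_algebra \<Rightarrow> complex) set"
  where "cochains n = {f \<in> functionals (coeff_tensor n).
    \<forall>x \<in> coeff_tensor n. \<forall>h. f (tensor_ract x h) = \<epsilon> h * f x}"

text \<open>In the last coface, \<open>as = [a\<^sub>0, \<dots>, a\<^sub>n]\<close> with \<open>n \<ge> 1\<close>, so that \<open>butlast (tl as)\<close> is
  \<open>[a\<^sub>1, \<dots>, a\<^bsub>n-1\<^esub>]\<close>.\<close>

definition coface ::
    "nat \<Rightarrow> nat \<Rightarrow> ('m \<otimes> 'a tensor_algebra \<Rightarrow> complex) \<Rightarrow> 'm \<otimes> 'a tensor_algebra \<Rightarrow> complex"
  where "coface n i f = functional_of n (\<lambda>m as.
    if i < n then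
      f (m \<otimes> pure_tensor (take i as @ (as ! i * as ! (i + 1)) # drop (i + 2) as))
    else
      sweedler (\<rho> m) (\<lambda>h m'. f (m' \<otimes> pure_tensor (((S_inv h \<rhd> last as) * hd as) # butlast (tl as)))))"

definition codegeneracy ::
    "nat \<Rightarrow> nat \<Rightarrow> ('m \<otimes> 'a tensor_algebra \<Rightarrow> complex) \<Rightarrow> 'm \<otimes> 'a tensor_algebra \<Rightarrow> complex"
  where "codegeneracy n i f = functional_of n (\<lambda>m as.
    f (m \<otimes> pure_tensor (take (i + 1) as @ 1 # drop (i + 1) as)))"

definition cyclic ::
    "nat \<Rightarrow> ('m \<otimes> 'a tensor_algebra \<Rightarrow> complex) \<Rightarrow> 'm \<otimes> 'a tensor_algebra \<Rightarrow> complex"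
  where "cyclic n f = functional_of n (\<lambda>m as.
    sweedler (\<rho> m) (\<lambda>h m'. f (m' \<otimes> pure_tensor ((S_inv h \<rhd> last as) # butlast as))))"

text \<open>For bijective \<open>S\<close>, the operators are defined on all functionals and satisfy the formulas that
  define them.\<close>

lemma clinear_S_inv:
  assumes "bij S" shows "clinear S_inv"
proof (rule clinearI)
  have inv: "S (S_inv x) = x" for x using assms by (simp add: bij_is_surj surj_f_inv_f)
  have inj: "S x = S y \<Longrightarrow> x = y" for x y using assms by (simp add: bij_is_inj inj_eq)
  show "S_inv (x + y) = S_inv x + S_inv y" for x y
    by (rule inj) (simp add: clinear_add[OF S_linear] inv)
  show "S_inv (c *\<^sub>C x) = c *\<^sub>C S_inv x" for c x
    by (rule inj) (simp add: clinear_scaleC[OF S_linear] inv)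
qed

lemma functional_clinear_slot:
  assumes f: "f \<in> functionals (coeff_tensor n)" and len: "length xs + length ys = n"
  shows "clinear (\<lambda>a. f (m \<otimes> pure_tensor (xs @ a # ys)))"
proof (rule clinearI)
  have lin: "clinear (\<lambda>a. m \<otimes> pure_tensor (xs @ a # ys))"
    using clinear_comp[OF clinear_right[OF cbilinear_tensor_pure]] multilinear_pure_tensor
    unfolding multilinear_def by blast
  have mem: "m \<otimes> pure_tensor (xs @ a # ys) \<in> coeff_tensor n" for a
    using len by (intro pure_in_coeff_tensor) simp
  show "f (m \<otimes> pure_tensor (xs @ (a + b) # ys)) =
      f (m \<otimes> pure_tensor (xs @ a # ys)) + f (m \<otimes> pure_tensor (xs @ b # ys))" for a b
    using f mem unfolding clinear_add[OF lin] functionals_def clinear_on_def by blast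
  show "f (m \<otimes> pure_tensor (xs @ (c *\<^sub>C a) # ys)) =
      c *\<^sub>C f (m \<otimes> pure_tensor (xs @ a # ys))" for c a
    using f mem unfolding clinear_scaleC[OF lin] functionals_def clinear_on_def by blast
qed

lemma functional_clinear_coeff:
  assumes f: "f \<in> functionals (coeff_tensor n)" and len: "length as = n + 1"
  shows "clinear (\<lambda>m. f (m \<otimes> pure_tensor as))"
proof (rule clinearI)
  note lin = clinear_left[OF cbilinear_tensor_pure, of "pure_tensor as"]
  have mem: "m \<otimes> pure_tensor as \<in> coeff_tensor n" for m
    using len by (rule pure_in_coeff_tensor)
  show "f ((m + m') \<otimes> pure_tensor as) = f (m \<otimes> pure_tensor as) + f (m' \<otimes> pure_tensor as)" for m m'
    using f mem unfolding clinear_add[OF lin] functionals_def clinear_on_def by blast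
  show "f ((c *\<^sub>C m) \<otimes> pure_tensor as) = c *\<^sub>C f (m \<otimes> pure_tensor as)" for c m
    using f mem unfolding clinear_scaleC[OF lin] functionals_def clinear_on_def by blast
qed

lemma clinear_mult_left: "clinear (\<lambda>x. x * y)" and clinear_mult_right: "clinear (\<lambda>y. x * y)"
  for x y :: 'a
  by (auto intro!: clinearI simp: algebra_simps scaleC_mult_left scaleC_mult_right)

lemma
  assumes S: "bij S" and f: "f \<in> functionals (coeff_tensor n)"
  shows cyclic_in: "cyclic n f \<in> functionals (coeff_tensor n)"
    and cyclic_pure: "length as = n + 1 \<Longrightarrow> cyclic n f (m \<otimes> pure_tensor as) =
      sweedler (\<rho> m) (\<lambda>h m'. f (m' \<otimes> pure_tensor ((S_inv h \<rhd> last as) # butlast as)))"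
proof -
  let ?g = "\<lambda>m as. sweedler (\<rho> m) (\<lambda>h m'. f (m' \<otimes> pure_tensor ((S_inv h \<rhd> last as) # butlast as)))"
  have bil: "cbilinear (\<lambda>h m'. f (m' \<otimes> pure_tensor ((S_inv h \<rhd> a) # as)))" if "length as = n" for a as
    unfolding cbilinear_def using that
    by (intro conjI allI functional_clinear_coeff[OF f] 
        clinear_comp[OF functional_clinear_slot[OF f, of "[]", simplified]]
        clinear_comp[OF clinear_left[OF act_bilinear] clinear_S_inv[OF S]]) simp_all
  have 1: "clinear (\<lambda>m. ?g m as)" if "length as = n + 1" for as
    using that by (intro clinear_comp[OF clinear_tensor_lift \<rho>_linear] bil) simp
  have 2: "clinear (\<lambda>a. ?g m (xs @ a # ys))" if len: "length xs + length ys = n" for m xs ys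
  proof (cases ys rule: rev_cases)
    case Nil
    have "clinear (\<lambda>a. sweedler (\<rho> m) (\<lambda>h m'. f (m' \<otimes> pure_tensor ((S_inv h \<rhd> a) # xs))))"
      using len Nil
      by (intro clinear_sweedler_param bil clinear_comp[OF functional_clinear_slot[OF f, of "[]", simplified]]
          clinear_right[OF act_bilinear]) simp_all
    then show ?thesis by (simp add: Nil)
  next
    case (snoc zs z)
    have "clinear (\<lambda>a. sweedler (\<rho> m) (\<lambda>h m'. f (m' \<otimes> pure_tensor ((S_inv h \<rhd> z) # xs @ a # zs))))"
      using len snoc functional_clinear_slot[OF f, of "_ # xs" zs]
      by (intro clinear_sweedler_param bil) simp_all
    then show ?thesis by (simp add: snoc butlast_append)
  qed
  show "cyclic n f \<in> functionals (coeff_tensor n)"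
    unfolding cyclic_def by (rule functional_of_in[OF 1 2])
  show "cyclic n f (m \<otimes> pure_tensor as) = ?g m as" if "length as = n + 1"
    unfolding cyclic_def by (rule functional_of_pure[OF 1 2 that])
qed

lemma
  assumes i: "i \<le> n" and f: "f \<in> functionals (coeff_tensor (n + 1))"
  shows codegeneracy_in: "codegeneracy n i f \<in> functionals (coeff_tensor n)"
    and codegeneracy_pure: "length as = n + 1 \<Longrightarrow> codegeneracy n i f (m \<otimes> pure_tensor as) =
      f (m \<otimes> pure_tensor (take (i + 1) as @ 1 # drop (i + 1) as))"
proof -
  let ?g = "\<lambda>m as. f (m \<otimes> pure_tensor (take (i + 1) as @ 1 # drop (i + 1) as))"
  have 1: "clinear (\<lambda>m. ?g m as)" if "length as = n + 1" for as
    using that i by (intro functional_clinear_coeff[OF f]) simp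
  have 2: "clinear (\<lambda>a. ?g m (xs @ a # ys))" if len: "length xs + length ys = n" for m xs ys
  proof (cases "length xs \<le> i")
    case True
    define k where "k = i - length xs"
    have k: "i + 1 - length xs = Suc k" "i + 1 \<ge> length xs" using True by (simp_all add: k_def)
    show ?thesis
      using functional_clinear_slot[OF f, of xs "take k ys @ 1 # drop k ys" m] len k i
      by simp
  next
    case False
    then have k: "length xs \<ge> i + 1" by simp
    show ?thesis
      using functional_clinear_slot[OF f, of "take (i + 1) xs @ 1 # drop (i + 1) xs" ys m] len k
      by simp
  qed
  show "codegeneracy n i f \<in> functionals (coeff_tensor n)"
    unfolding codegeneracy_def by (rule functional_of_in[OF 1 2])
  show "codegeneracy n i f (m \<otimes> pure_tensor as) = ?g m as" if "length as = n + 1"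
    unfolding codegeneracy_def by (rule functional_of_pure[OF 1 2 that])
qed

lemma
  assumes i: "i < n" and f: "f \<in> functionals (coeff_tensor (n - 1))"
  shows coface_in: "coface n i f \<in> functionals (coeff_tensor n)"
    and coface_pure: "length as = n + 1 \<Longrightarrow> coface n i f (m \<otimes> pure_tensor as) =
      f (m \<otimes> pure_tensor (take i as @ (as ! i * as ! (i + 1)) # drop (i + 2) as))"
proof -
  let ?g = "\<lambda>m as. f (m \<otimes> pure_tensor (take i as @ (as ! i * as ! (i + 1)) # drop (i + 2) as))"
  have 1: "clinear (\<lambda>m. ?g m as)" if "length as = n + 1" for as
    using that i by (intro functional_clinear_coeff[OF f]) simp
  have 2: "clinear (\<lambda>a. ?g m (xs @ a # ys))" if len: "length xs + length ys = n" for m xs ys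
  proof -
    consider k where "i = Suc (length xs + k)" | "i = length xs" | "length xs = Suc i"
      | "length xs \<ge> i + 2"
      by (metis Suc_leI add_2_eq_Suc' less_iff_Suc_add linorder_cases le_neq_implies_less)
    then show ?thesis
    proof cases
      case (1 k)
      show ?thesis
        using functional_clinear_slot[OF f, of xs "take k ys @ (ys ! k * ys ! Suc k) # drop (k + 2) ys" m]
          1 len i by (simp add: nth_append nth_Cons' numeral_3_eq_3)
    next
      case 2
      then show ?thesis
        using clinear_comp[OF functional_clinear_slot[OF f, of xs "drop 1 ys" m]
            clinear_mult_left[of "ys ! 0"]] len i by (simp add: nth_append)
    next
      case 3
      then show ?thesis
        using clinear_comp[OF functional_clinear_slot[OF f, of "take i xs" ys m]
            clinear_mult_right[of "xs ! i"]] len i by (simp add: nth_append)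
    next
      case 4
      then show ?thesis
        using functional_clinear_slot[OF f, of "take i xs @ (xs ! i * xs ! Suc i) # drop (i + 2) xs" ys m]
          len i by (simp add: nth_append)
    qed
  qed
  show "coface n i f \<in> functionals (coeff_tensor n)"
    unfolding coface_def using i functional_of_in[OF 1 2] by simp
  show "coface n i f (m \<otimes> pure_tensor as) = ?g m as" if "length as = n + 1"
    unfolding coface_def using i functional_of_pure[OF 1 2 that] by simp
qed

lemma
  assumes S: "bij S" and n: "n \<ge> 1" and f: "f \<in> functionals (coeff_tensor (n - 1))"
  shows last_coface_in: "coface n n f \<in> functionals (coeff_tensor n)"
    and last_coface_pure: "length bs = n - 1 \<Longrightarrow> coface n n f (m \<otimes> pure_tensor (a # bs @ [b])) =
      sweedler (\<rho> m) (\<lambda>h m'. f (m' \<otimes> pure_tensor (((S_inv h \<rhd> b) * a) # bs)))"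
proof -
  let ?g = "\<lambda>m as. sweedler (\<rho> m)
    (\<lambda>h m'. f (m' \<otimes> pure_tensor (((S_inv h \<rhd> last as) * hd as) # butlast (tl as))))"
  note slot = functional_clinear_slot[OF f, of "[]", simplified]
  have bil: "cbilinear (\<lambda>h m'. f (m' \<otimes> pure_tensor (((S_inv h \<rhd> a) * b) # as)))"
    if "length as = n - 1" for a b as
    unfolding cbilinear_def using that n
    by (intro conjI allI functional_clinear_coeff[OF f] clinear_comp[OF slot]
        clinear_comp[OF clinear_mult_left] clinear_comp[OF clinear_left[OF act_bilinear] clinear_S_inv[OF S]])
      simp_all
  have 1: "clinear (\<lambda>m. ?g m as)" if "length as = n + 1" for as
    using that by (intro clinear_comp[OF clinear_tensor_lift \<rho>_linear] bil) simp
  have 2: "clinear (\<lambda>a. ?g m (xs @ a # ys))" if len: "length xs + length ys = n" for m xs ys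
  proof (cases xs)
    case Nil
    then obtain zs z where ys: "ys = zs @ [z]" using len n by (cases ys rule: rev_cases) auto
    have "clinear (\<lambda>a. sweedler (\<rho> m) (\<lambda>h m'. f (m' \<otimes> pure_tensor (((S_inv h \<rhd> z) * a) # zs))))"
      using len Nil ys
      by (intro clinear_sweedler_param bil clinear_comp[OF slot] clinear_mult_right) simp_all
    then show ?thesis by (simp add: Nil ys)
  next
    case (Cons x us)
    show ?thesis
    proof (cases ys rule: rev_cases)
      case Nil
      have "clinear (\<lambda>a. sweedler (\<rho> m) (\<lambda>h m'. f (m' \<otimes> pure_tensor (((S_inv h \<rhd> a) * x) # us))))"
        using len Nil Cons
        by (intro clinear_sweedler_param bil clinear_comp[OF slot] clinear_comp[OF clinear_mult_left]
            clinear_right[OF act_bilinear]) simp_all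
      then show ?thesis by (simp add: Nil Cons)
    next
      case (snoc zs z)
      have "clinear (\<lambda>a. sweedler (\<rho> m)
          (\<lambda>h m'. f (m' \<otimes> pure_tensor (((S_inv h \<rhd> z) * x) # us @ a # zs))))"
        using len snoc Cons functional_clinear_slot[OF f, of "_ # us" zs]
        by (intro clinear_sweedler_param bil) simp_all
      then show ?thesis by (simp add: snoc Cons butlast_append)
    qed
  qed
  show "coface n n f \<in> functionals (coeff_tensor n)"
    unfolding coface_def using functional_of_in[OF 1 2] by simp
  show "coface n n f (m \<otimes> pure_tensor (a # bs @ [b])) =
      sweedler (\<rho> m) (\<lambda>h m'. f (m' \<otimes> pure_tensor (((S_inv h \<rhd> b) * a) # bs)))"
    if "length bs = n - 1"
    unfolding coface_def using n that by (subst functional_of_pure) (use 1 2 in auto)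
qed

end

locale AH_SAYD = AH_module_comodule +
  assumes anti_yetter_drinfeld:
    "sweedler (\<rho> (m \<lhd> h)) (\<lambda>k m'. (S_inv k \<rhd> a) \<otimes> m') =
      sweedler (\<rho> m) (\<lambda>k m'. sweedler (\<Delta> h) (\<lambda>h1 h'. sweedler (\<Delta> h') (\<lambda>h2 h3.
        ((S_inv (k * h1) * h3) \<rhd> a) \<otimes> (m' \<lhd> h2))))"
    and stable: "\<phi> \<in> cochains n \<Longrightarrow> length as = n + 1 \<Longrightarrow>
      sweedler (\<rho> m) (\<lambda>h m'. \<phi> (m' \<otimes> diag (S_inv h) (pure_tensor as))) = \<phi> (m \<otimes> pure_tensor as)"

text \<open>The cocyclic module axioms contain that the operators preserve \<open>H\<close>-linearity of functionals.\<close>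

locale AH_HCC = AH_module_comodule +
  assumes cocyclic: "cocyclic_module cochains coface codegeneracy cyclic"

end

theory Submission
  imports Defs
begin

text \<open>The proof rests on a reformulation of \<open>H\<close>-linearity. A functional \<open>f\<close> on
  \<open>M \<otimes> A\<^sup>\<otimes>\<^sup>(\<^sup>n\<^sup>+\<^sup>1\<^sup>)\<close> is \<open>H\<close>-linear if and only if \<open>f (m h \<otimes> x) = f (m \<otimes> h x)\<close>, with \<open>H\<close> acting
  diagonally on the right (lemma \<open>cochains_iff\<close>): the antipode axioms let \<open>S(h\<^sub>2)\<close> pass from one tensor
  factor to the other. In this form the inner cofaces and the codegeneracies preserve
  \<open>H\<close>-linearity because multiplication and unit of \<open>A\<close> are compatible with the action.

  For the cyclic operator \<open>t\<close>, the anti-Yetter-Drinfeld condition and the reformulation give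
  \<open>f ((m h)\<^sub>0 \<otimes> S\<^sup>-\<^sup>1((m h)\<^sub>-\<^sub>1) a\<^sub>n \<otimes> \<dots>) = f (m\<^sub>0 \<otimes> h\<^sub>2 S\<^sup>-\<^sup>1(h\<^sub>1) S\<^sup>-\<^sup>1(m\<^sub>-\<^sub>1) h\<^sub>4 a\<^sub>n \<otimes> h\<^sub>3 (\<dots>))\<close>, and
  \<open>h\<^sub>2 S\<^sup>-\<^sup>1(h\<^sub>1) = \<epsilon>(h)\<close> turns this into the value of \<open>t f\<close> at \<open>m \<otimes> h (a\<^sub>0 \<otimes> \<dots> \<otimes> a\<^sub>n)\<close>
  (lemma \<open>cyclic_cochain\<close>). Iterating \<open>t\<close> rotates the letters one by one; since \<open>S\<^sup>-\<^sup>1\<close> reverses the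
  coproduct, the coaction factors collected by \<open>n + 1\<close> rotations assemble to the diagonal action of
  \<open>S\<^sup>-\<^sup>1(m\<^sub>-\<^sub>1)\<close>, and stability says that \<open>t\<^sup>n\<^sup>+\<^sup>1 = 1\<close> (lemma \<open>cyclic_power_cochain\<close>).

  The other relations are identities of operators on arbitrary functionals. Those between inner
  cofaces and codegeneracies are identities of words over \<open>A\<close>. The last coface is \<open>d\<^sub>n = t d\<^sub>0\<close>, so its
  relations mostly follow from the inner ones and from \<open>t d\<^sub>i\<^sub>+\<^sub>1 = d\<^sub>i t\<close> and \<open>t s\<^sub>i\<^sub>+\<^sub>1 = s\<^sub>i t\<close>; three
  identities are computed directly: \<open>t d\<^sub>n = d\<^sub>n\<^sub>-\<^sub>1 t\<close>, \<open>t s\<^sub>0 = s\<^sub>n t\<^sup>2\<close> and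
  \<open>s\<^sub>n d\<^sub>n\<^sub>+\<^sub>1 = 1\<close>.\<close>


section \<open>Sweedler sums\<close>

lemma clinear_id: "clinear (\<lambda>x. x)"
  by (simp add: clinear_iff)

lemma cbilinearI:
  "(\<And>x. clinear (f x)) \<Longrightarrow> (\<And>y. clinear (\<lambda>x. f x y)) \<Longrightarrow> cbilinear f"
  by (simp add: cbilinear_def)

lemma clinear_bilinear_left: "cbilinear f \<Longrightarrow> clinear g \<Longrightarrow> clinear (\<lambda>x. f (g x) y)"
  by (rule clinear_comp[OF clinear_left])

lemma clinear_bilinear_right: "cbilinear f \<Longrightarrow> clinear g \<Longrightarrow> clinear (\<lambda>x. f y (g x))"
  by (rule clinear_comp[OF clinear_right])

lemma cbilinear_scaleC: "cbilinear ((*\<^sub>C) :: complex \<Rightarrow> 'a \<Rightarrow> 'a::complex_vector)"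
  by (simp add: cbilinear_iff scaleC_add_right scaleC_add_left scaleC_scaleC scaleC_complex_def
      mult.commute)

lemma cbilinear_mult: "cbilinear ((*) :: 'a \<Rightarrow> 'a \<Rightarrow> 'a::complex_unital_algebra)"
  by (simp add: cbilinear_iff distrib_left distrib_right scaleC_mult_left scaleC_mult_right)

lemma clinear_sweedler: "cbilinear f \<Longrightarrow> clinear g \<Longrightarrow> clinear (\<lambda>x. sweedler (g x) f)"
  by (rule clinear_comp[OF clinear_tensor_lift])

text \<open>Rearranging Sweedler sums requires at each step that the summands be bilinear. These rules
  settle such conditions by following the syntax of the summand; later lists add the structure maps
  of the objects at hand.\<close>

lemmas linear_intros =
  clinear_id cbilinearI clinear_sweedler clinear_sweedler_param
  clinear_bilinear_left[OF cbilinear_scaleC] clinear_bilinear_right[OF cbilinear_scaleC]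
  clinear_bilinear_left[OF cbilinear_mult] clinear_bilinear_right[OF cbilinear_mult]
  clinear_bilinear_left[OF cbilinear_tensor_pure] clinear_bilinear_right[OF cbilinear_tensor_pure]
  clinear_bilinear_left[OF cbilinear_tensor_cons] clinear_bilinear_right[OF cbilinear_tensor_cons]

lemma linear_sweedler:
  assumes L: "clinear L" and f: "cbilinear f"
  shows "L (sweedler t f) = sweedler t (\<lambda>x y. L (f x y))"
proof -
  have Lf: "cbilinear (\<lambda>x y. L (f x y))"
    by (intro cbilinearI clinear_comp[OF L] clinear_left[OF f] clinear_right[OF f])
  have "(\<lambda>t. L (sweedler t f)) = (\<lambda>t. sweedler t (\<lambda>x y. L (f x y)))"
    by (rule tensor_eqI[OF clinear_comp[OF L clinear_tensor_lift[OF f]] clinear_tensor_lift[OF Lf]])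
      (simp add: tensor_lift_pure[OF f] tensor_lift_pure[OF Lf])
  then show ?thesis by metis
qed

lemma sweedler_swap:
  assumes "\<And>z w. cbilinear (\<lambda>x y. f x y z w)" and "\<And>x y. cbilinear (f x y)"
  shows "sweedler t (\<lambda>x y. sweedler u (f x y)) = sweedler u (\<lambda>z w. sweedler t (\<lambda>x y. f x y z w))"
proof -
  have l: "cbilinear (\<lambda>x y. sweedler u (f x y))"
    by (intro linear_intros assms clinear_left[OF assms(1)] clinear_right[OF assms(1)])
  have r: "clinear (\<lambda>t. sweedler u (\<lambda>z w. sweedler t (\<lambda>x y. f x y z w)))"
    by (intro linear_intros assms clinear_left[OF assms(1)] clinear_right[OF assms(1)]
      clinear_left[OF assms(2)] clinear_right[OF assms(2)])
  have "tensor_lift (\<lambda>x y. sweedler u (f x y)) = (\<lambda>t. sweedler u (\<lambda>z w. sweedler t (\<lambda>x y. f x y z w)))"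
    by (rule tensor_eqI[OF clinear_tensor_lift[OF l] r])
      (simp add: tensor_lift_pure[OF l] tensor_lift_pure[OF assms(1)])
  then show ?thesis by metis
qed

lemma sweedler_add:
  assumes "cbilinear f" "cbilinear g"
  shows "sweedler t (\<lambda>x y. f x y + g x y) = sweedler t f + sweedler t g"
proof -
  have b: "cbilinear (\<lambda>x y. f x y + g x y)"
    using assms by (simp add: cbilinear_iff scaleC_add_right algebra_simps)
  have "tensor_lift (\<lambda>x y. f x y + g x y) = (\<lambda>t. sweedler t f + sweedler t g)"
  proof (rule tensor_eqI[OF clinear_tensor_lift[OF b]])
    show "clinear (\<lambda>t. sweedler t f + sweedler t g)"
      using clinear_tensor_lift[OF assms(1)] clinear_tensor_lift[OF assms(2)]
      by (simp add: clinear_iff scaleC_add_right algebra_simps)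
  qed (simp add: tensor_lift_pure assms b)
  then show ?thesis by metis
qed

lemma sweedler_in_subspace:
  assumes V: "complex_vector.subspace V" and f: "cbilinear f" and mem: "\<And>x y. f x y \<in> V"
  shows "sweedler t f \<in> V"
proof -
  have "t \<in> complex_vector.span {x \<otimes> y | x y. True}" unfolding tensor_span by simp
  then show ?thesis
  proof (induct rule: complex_vector.span_induct_alt)
    case base
    then show ?case
      using V by (simp add: clinear_0[OF clinear_tensor_lift[OF f]] complex_vector.subspace_0)
  next
    case (step c x y)
    then show ?case
      using V mem
      by (auto simp: clinear_add[OF clinear_tensor_lift[OF f]] clinear_scaleC[OF clinear_tensor_lift[OF f]]
          tensor_lift_pure[OF f] intro!: complex_vector.subspace_add complex_vector.subspace_scale)
  qed
qed

lemma sweedler_cong: "(\<And>x y. f x y = g x y) \<Longrightarrow> sweedler t f = sweedler t g"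
  by (rule arg_cong[of f g "\<lambda>f. tensor_lift f t"]) (intro ext, simp)

text \<open>A coassociativity law is an equation between triple tensors. Applying to it the linear map
  induced by a trilinear \<open>f\<close> turns it into a rule for regrouping nested Sweedler sums. It serves both
  the coproduct (\<open>D = E = \<Delta>\<close>) and coactions (\<open>D = \<Delta>\<close>, \<open>E = \<rho>\<close>).\<close>

lemma sweedler_assoc:
  assumes eq: "sweedler t (\<lambda>x y. sweedler (D x) (\<lambda>x1 x2. x1 \<otimes> x2 \<otimes> y)) =
      sweedler t (\<lambda>x y. x \<otimes> E y)"
    and D: "clinear D" and E: "clinear E"
    and f: "\<And>y z. clinear (\<lambda>x. f x y z)" "\<And>x z. clinear (\<lambda>y. f x y z)" "\<And>x y. clinear (f x y)"
  shows "sweedler t (\<lambda>x y. sweedler (D x) (\<lambda>x1 x2. f x1 x2 y)) =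
    sweedler t (\<lambda>x y. sweedler (E y) (f x))"
proof -
  have fx: "cbilinear (f x)" for x by (intro cbilinearI f)
  have b: "cbilinear (\<lambda>x. tensor_lift (f x))"
    by (intro linear_intros f clinear_tensor_lift fx)
  let ?L = "tensor_lift (\<lambda>x. tensor_lift (f x))"
  note L = clinear_tensor_lift[OF b] and P = tensor_lift_pure[OF b]
  have "?L (sweedler t (\<lambda>x y. sweedler (D x) (\<lambda>x1 x2. x1 \<otimes> x2 \<otimes> y))) =
      sweedler t (\<lambda>x y. ?L (sweedler (D x) (\<lambda>x1 x2. x1 \<otimes> x2 \<otimes> y)))"
    by (intro linear_sweedler L linear_intros D)
  also have "\<dots> = sweedler t (\<lambda>x y. sweedler (D x) (\<lambda>x1 x2. ?L (x1 \<otimes> x2 \<otimes> y)))"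
    by (intro sweedler_cong linear_sweedler L linear_intros)
  also have "\<dots> = sweedler t (\<lambda>x y. sweedler (D x) (\<lambda>x1 x2. f x1 x2 y))"
    by (simp add: P tensor_lift_pure[OF fx])
  finally have l: "?L (sweedler t (\<lambda>x y. sweedler (D x) (\<lambda>x1 x2. x1 \<otimes> x2 \<otimes> y))) = \<dots>" .
  have "?L (sweedler t (\<lambda>x y. x \<otimes> E y)) = sweedler t (\<lambda>x y. ?L (x \<otimes> E y))"
    by (intro linear_sweedler L linear_intros E)
  then show ?thesis using l eq by (simp add: P)
qed


section \<open>Identities for the antipode\<close>

context hopf_algebra
begin

lemmas hopf_linear_intros = linear_intros
  clinear_comp[OF \<Delta>_linear] clinear_comp[OF \<epsilon>_linear] clinear_comp[OF S_linear]

lemmas sweedler_coassoc = sweedler_assoc[OF coassoc \<Delta>_linear \<Delta>_linear]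

lemma sweedler_counit_left:
  assumes "clinear f" shows "sweedler (\<Delta> h) (\<lambda>x y. \<epsilon> x *\<^sub>C f y) = f h"
proof -
  have "f (sweedler (\<Delta> h) (\<lambda>x y. \<epsilon> x *\<^sub>C y)) = sweedler (\<Delta> h) (\<lambda>x y. f (\<epsilon> x *\<^sub>C y))"
    by (intro linear_sweedler assms hopf_linear_intros)
  then show ?thesis by (simp add: counit_left clinear_scaleC[OF assms])
qed

lemma sweedler_counit_right:
  assumes "clinear f" shows "sweedler (\<Delta> h) (\<lambda>x y. \<epsilon> y *\<^sub>C f x) = f h"
proof -
  have "f (sweedler (\<Delta> h) (\<lambda>x y. \<epsilon> y *\<^sub>C x)) = sweedler (\<Delta> h) (\<lambda>x y. f (\<epsilon> y *\<^sub>C x))"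
    by (intro linear_sweedler assms hopf_linear_intros)
  then show ?thesis by (simp add: counit_right clinear_scaleC[OF assms])
qed

lemma sweedler_antipode_left:
  assumes "clinear f" shows "sweedler (\<Delta> h) (\<lambda>x y. f (S x * y)) = \<epsilon> h *\<^sub>C f 1"
proof -
  have "f (sweedler (\<Delta> h) (\<lambda>x y. S x * y)) = sweedler (\<Delta> h) (\<lambda>x y. f (S x * y))"
    by (intro linear_sweedler assms hopf_linear_intros)
  then show ?thesis by (simp add: antipode_left clinear_scaleC[OF assms])
qed

lemma sweedler_antipode_right:
  assumes "clinear f" shows "sweedler (\<Delta> h) (\<lambda>x y. f (x * S y)) = \<epsilon> h *\<^sub>C f 1"
proof -
  have "f (sweedler (\<Delta> h) (\<lambda>x y. x * S y)) = sweedler (\<Delta> h) (\<lambda>x y. f (x * S y))"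
    by (intro linear_sweedler assms hopf_linear_intros)
  then show ?thesis by (simp add: antipode_right clinear_scaleC[OF assms])
qed

lemma sweedler_mult:
  assumes f: "cbilinear f"
  shows "sweedler (\<Delta> (h * k)) f =
    sweedler (\<Delta> h) (\<lambda>h1 h2. sweedler (\<Delta> k) (\<lambda>k1 k2. f (h1 * k1) (h2 * k2)))"
proof -
  note L = clinear_tensor_lift[OF f]
  have "sweedler (\<Delta> (h * k)) f =
      sweedler (\<Delta> h) (\<lambda>h1 h2. sweedler (sweedler (\<Delta> k) (\<lambda>k1 k2. (h1 * k1) \<otimes> (h2 * k2))) f)"
    unfolding \<Delta>_mult by (intro linear_sweedler[OF L] hopf_linear_intros)
  also have "\<dots> = sweedler (\<Delta> h) (\<lambda>h1 h2. sweedler (\<Delta> k) (\<lambda>k1 k2. sweedler ((h1 * k1) \<otimes> (h2 * k2)) f))"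
    by (intro sweedler_cong linear_sweedler[OF L] hopf_linear_intros)
  finally show ?thesis by (simp add: tensor_lift_pure[OF f])
qed

text \<open>Both sides are values of \<open>S(h\<^sub>1 k\<^sub>1) h\<^sub>2 k\<^sub>2 S(k\<^sub>3) S(h\<^sub>3)\<close>: contracting \<open>S(h\<^sub>1 k\<^sub>1)\<close> with
  \<open>h\<^sub>2 k\<^sub>2\<close> leaves \<open>S(k) S(h)\<close>, while contracting \<open>k\<^sub>2 S(k\<^sub>3)\<close> and then \<open>h\<^sub>2 S(h\<^sub>3)\<close> leaves \<open>S(h k)\<close>.\<close>

lemma antipode_mult: "S (h * k) = S k * S h"
proof -
  have "S k * S h = sweedler (\<Delta> h) (\<lambda>x h3. \<epsilon> x *\<^sub>C (S k * S h3))"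
    by (rule sweedler_counit_left[symmetric]) (intro hopf_linear_intros)
  also have "\<dots> = sweedler (\<Delta> h) (\<lambda>x h3. sweedler (\<Delta> k) (\<lambda>y k3. \<epsilon> y *\<^sub>C \<epsilon> x *\<^sub>C (S k3 * S h3)))"
    by (intro sweedler_cong sweedler_counit_left[symmetric] hopf_linear_intros)
  also have "\<dots> = sweedler (\<Delta> h) (\<lambda>x h3. sweedler (\<Delta> k) (\<lambda>y k3.
      sweedler (\<Delta> (x * y)) (\<lambda>u v. S u * v * (S k3 * S h3))))"
    by (subst sweedler_antipode_left[where f = "\<lambda>z. z * _"])
       (intro hopf_linear_intros, simp add: \<epsilon>_mult scaleC_scaleC mult.commute)
  also have "\<dots> = sweedler (\<Delta> h) (\<lambda>x h3. sweedler (\<Delta> k) (\<lambda>y k3.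
      sweedler (\<Delta> x) (\<lambda>x1 x2. sweedler (\<Delta> y) (\<lambda>y1 y2. S (x1 * y1) * x2 * y2 * S k3 * S h3))))"
    by (subst sweedler_mult) (intro hopf_linear_intros, simp add: mult.assoc)
  also have "\<dots> = sweedler (\<Delta> h) (\<lambda>x h3. sweedler (\<Delta> x) (\<lambda>x1 x2. sweedler (\<Delta> k) (\<lambda>y k3.
      sweedler (\<Delta> y) (\<lambda>y1 y2. S (x1 * y1) * x2 * y2 * S k3 * S h3))))"
    by (intro sweedler_cong sweedler_swap hopf_linear_intros)
  also have "\<dots> = sweedler (\<Delta> h) (\<lambda>x h3. sweedler (\<Delta> x) (\<lambda>x1 x2. sweedler (\<Delta> k) (\<lambda>y1 y.
      sweedler (\<Delta> y) (\<lambda>y2 k3. S (x1 * y1) * x2 * y2 * S k3 * S h3))))"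
    by (intro sweedler_cong sweedler_coassoc hopf_linear_intros)
  also have "\<dots> = sweedler (\<Delta> h) (\<lambda>x h3. sweedler (\<Delta> x) (\<lambda>x1 x2. sweedler (\<Delta> k) (\<lambda>y1 y.
      \<epsilon> y *\<^sub>C (S (x1 * y1) * x2 * S h3))))"
    using sweedler_antipode_right[where f = "\<lambda>z. S (_ * _) * _ * z * S _"]
    by (simp add: hopf_linear_intros mult.assoc)
  also have "\<dots> = sweedler (\<Delta> h) (\<lambda>x h3. sweedler (\<Delta> x) (\<lambda>x1 x2. S (x1 * k) * x2 * S h3))"
    by (intro sweedler_cong sweedler_counit_right hopf_linear_intros)
  also have "\<dots> = sweedler (\<Delta> h) (\<lambda>x1 x. sweedler (\<Delta> x) (\<lambda>x2 h3. S (x1 * k) * x2 * S h3))"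
    by (intro sweedler_coassoc hopf_linear_intros)
  also have "\<dots> = sweedler (\<Delta> h) (\<lambda>x1 x. \<epsilon> x *\<^sub>C S (x1 * k))"
    using sweedler_antipode_right[where f = "\<lambda>z. S (_ * k) * z"]
    by (simp add: hopf_linear_intros mult.assoc)
  also have "\<dots> = S (h * k)"
    by (intro sweedler_counit_right hopf_linear_intros)
  finally show ?thesis by simp
qed


lemma antipode_one: "S 1 = 1"
  using antipode_left[of 1] by (simp add: \<Delta>_one tensor_lift_pure hopf_linear_intros \<epsilon>_one scaleC_one)

lemma counit_antipode: "\<epsilon> (S h) = \<epsilon> h"
proof -
  have "\<epsilon> (S h) = sweedler (\<Delta> h) (\<lambda>x y. \<epsilon> y *\<^sub>C \<epsilon> (S x))"
    by (intro sweedler_counit_right[symmetric] hopf_linear_intros)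
  also have "\<dots> = sweedler (\<Delta> h) (\<lambda>x y. \<epsilon> (S x * y))"
    by (simp add: \<epsilon>_mult scaleC_complex_def mult.commute)
  also have "\<dots> = \<epsilon> h"
    by (simp add: sweedler_antipode_left[OF \<epsilon>_linear] \<epsilon>_one scaleC_complex_def)
  finally show ?thesis .
qed

text \<open>The formula \<open>\<Delta>(S(h)) = S(h\<^sub>2) \<otimes> S(h\<^sub>1)\<close>. Both sides are values of
  \<open>\<Delta>(S(h\<^sub>1)) (h\<^sub>2 S(h\<^sub>5) \<otimes> h\<^sub>3 S(h\<^sub>4))\<close>: contracting \<open>\<Delta>(S(h\<^sub>1))\<close> with \<open>\<Delta>(h\<^sub>2)\<close> gives the right-hand side,
  contracting \<open>h\<^sub>3 S(h\<^sub>4)\<close> and then the remaining \<open>h\<^sub>2 S(h\<^sub>3)\<close> gives the left-hand side.\<close>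

lemma sweedler_antipode:
  assumes f: "cbilinear f"
  shows "sweedler (\<Delta> (S h)) f = sweedler (\<Delta> h) (\<lambda>x y. f (S y) (S x))"
proof -
  note intros = hopf_linear_intros clinear_bilinear_left[OF f] clinear_bilinear_right[OF f]
  define K where "K p q1 q2 x y = sweedler (\<Delta> (S p)) (\<lambda>c d. f (c * q1 * S y) (d * (q2 * S x)))"
    for p q1 q2 x y
  have K: "clinear (\<lambda>p. K p q1 q2 x y)" "clinear (\<lambda>q1. K p q1 q2 x y)"
    "clinear (\<lambda>q2. K p q1 q2 x y)" "clinear (\<lambda>x. K p q1 q2 x y)" "clinear (\<lambda>y. K p q1 q2 x y)"
    for p q1 q2 x y
    unfolding K_def by (intro intros)+
  have "sweedler (\<Delta> h) (\<lambda>x y. f (S y) (S x)) =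
      sweedler (\<Delta> h) (\<lambda>u w. \<epsilon> u *\<^sub>C sweedler (\<Delta> w) (\<lambda>x y. f (S y) (S x)))"
    by (intro sweedler_counit_left[symmetric] intros)
  also have "\<dots> = sweedler (\<Delta> h) (\<lambda>u w. sweedler (\<Delta> u) (\<lambda>p q.
      sweedler (\<Delta> (S p * q)) (\<lambda>a b. sweedler (\<Delta> w) (\<lambda>x y. f (a * S y) (b * S x)))))"
  proof (rule sweedler_cong)
    fix u w
    have "sweedler (\<Delta> u) (\<lambda>p q.
        sweedler (\<Delta> (S p * q)) (\<lambda>a b. sweedler (\<Delta> w) (\<lambda>x y. f (a * S y) (b * S x)))) =
      \<epsilon> u *\<^sub>C sweedler (\<Delta> 1) (\<lambda>a b. sweedler (\<Delta> w) (\<lambda>x y. f (a * S y) (b * S x)))"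
      by (intro sweedler_antipode_left intros)
    also have "\<dots> = \<epsilon> u *\<^sub>C sweedler (\<Delta> w) (\<lambda>x y. f (1 * S y) (1 * S x))"
      unfolding \<Delta>_one by (subst tensor_lift_pure) (intro intros, rule refl)
    finally show "\<epsilon> u *\<^sub>C sweedler (\<Delta> w) (\<lambda>x y. f (S y) (S x)) = sweedler (\<Delta> u) (\<lambda>p q.
        sweedler (\<Delta> (S p * q)) (\<lambda>a b. sweedler (\<Delta> w) (\<lambda>x y. f (a * S y) (b * S x))))"
      by simp
  qed
  also have "\<dots> = sweedler (\<Delta> h) (\<lambda>u w. sweedler (\<Delta> u) (\<lambda>p q.
      sweedler (\<Delta> q) (\<lambda>q1 q2. sweedler (\<Delta> w) (\<lambda>x y. K p q1 q2 x y))))"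
  proof (intro sweedler_cong)
    fix w p q
    have "sweedler (\<Delta> (S p * q)) (\<lambda>a b. sweedler (\<Delta> w) (\<lambda>x y. f (a * S y) (b * S x))) =
      sweedler (\<Delta> (S p)) (\<lambda>c d. sweedler (\<Delta> q) (\<lambda>q1 q2. sweedler (\<Delta> w) (\<lambda>x y.
        f (c * q1 * S y) (d * q2 * S x))))"
      by (intro sweedler_mult intros)
    also have "\<dots> = sweedler (\<Delta> q) (\<lambda>q1 q2. sweedler (\<Delta> (S p)) (\<lambda>c d. sweedler (\<Delta> w) (\<lambda>x y.
        f (c * q1 * S y) (d * q2 * S x))))"
      by (intro sweedler_swap intros)
    also have "\<dots> = sweedler (\<Delta> q) (\<lambda>q1 q2. sweedler (\<Delta> w) (\<lambda>x y. sweedler (\<Delta> (S p)) (\<lambda>c d.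
        f (c * q1 * S y) (d * q2 * S x))))"
      by (intro sweedler_cong sweedler_swap intros)
    finally show "sweedler (\<Delta> (S p * q)) (\<lambda>a b. sweedler (\<Delta> w) (\<lambda>x y. f (a * S y) (b * S x))) =
      sweedler (\<Delta> q) (\<lambda>q1 q2. sweedler (\<Delta> w) (\<lambda>x y. K p q1 q2 x y))"
      by (simp add: K_def mult.assoc)
  qed
  also have "\<dots> = sweedler (\<Delta> h) (\<lambda>p v. sweedler (\<Delta> v) (\<lambda>q w.
      sweedler (\<Delta> q) (\<lambda>q1 q2. sweedler (\<Delta> w) (\<lambda>x y. K p q1 q2 x y))))"
    by (intro sweedler_coassoc intros K)
  also have "\<dots> = sweedler (\<Delta> h) (\<lambda>p v. sweedler (\<Delta> v) (\<lambda>q1 z.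
      sweedler (\<Delta> z) (\<lambda>q2 w. sweedler (\<Delta> w) (\<lambda>x y. K p q1 q2 x y))))"
    by (intro sweedler_cong sweedler_coassoc intros K)
  also have "\<dots> = sweedler (\<Delta> h) (\<lambda>p v. sweedler (\<Delta> v) (\<lambda>q1 z.
      sweedler (\<Delta> z) (\<lambda>w y. sweedler (\<Delta> w) (\<lambda>q2 x. K p q1 q2 x y))))"
    by (intro sweedler_cong sweedler_coassoc[symmetric] intros K)
  also have "\<dots> = sweedler (\<Delta> h) (\<lambda>p v. sweedler (\<Delta> v) (\<lambda>q1 z.
      sweedler (\<Delta> z) (\<lambda>w y. \<epsilon> w *\<^sub>C sweedler (\<Delta> (S p)) (\<lambda>c d. f (c * q1 * S y) (d * 1)))))"
    unfolding K_def by (intro sweedler_cong sweedler_antipode_right intros)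
  also have "\<dots> = sweedler (\<Delta> h) (\<lambda>p v. sweedler (\<Delta> v) (\<lambda>q1 z.
      sweedler (\<Delta> (S p)) (\<lambda>c d. f (c * (q1 * S z)) d)))"
    by (simp only: mult.assoc mult_1_right) (intro sweedler_cong sweedler_counit_left intros)
  also have "\<dots> = sweedler (\<Delta> h) (\<lambda>p v. \<epsilon> v *\<^sub>C sweedler (\<Delta> (S p)) (\<lambda>c d. f (c * 1) d))"
    by (intro sweedler_cong sweedler_antipode_right intros)
  also have "\<dots> = sweedler (\<Delta> (S h)) (\<lambda>c d. f (c * 1) d)"
    by (intro sweedler_counit_right intros)
  finally show ?thesis by simp
qed

context
  assumes bij_S: "bij S"
begin

lemma S_inv_S [simp]: "inv S (S h) = h"
  using bij_S by (simp add: bij_is_inj)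

lemma S_S_inv [simp]: "S (inv S h) = h"
  using bij_S by (simp add: bij_is_surj surj_f_inv_f)

lemma inverse_antipode_linear: "clinear (inv S)"
proof (rule clinearI)
  show "inv S (x + y) = inv S x + inv S y" for x y
    by (metis S_S_inv S_inv_S clinear_add[OF S_linear])
  show "inv S (c *\<^sub>C x) = c *\<^sub>C inv S x" for c x
    by (metis S_S_inv S_inv_S clinear_scaleC[OF S_linear])
qed

lemma inverse_antipode_mult: "inv S (h * k) = inv S k * inv S h"
  by (metis S_S_inv S_inv_S antipode_mult)

lemma counit_inverse_antipode: "\<epsilon> (inv S h) = \<epsilon> h"
  by (metis S_S_inv counit_antipode)

lemma sweedler_inverse_antipode:
  assumes f: "cbilinear f"
  shows "sweedler (\<Delta> (inv S h)) f = sweedler (\<Delta> h) (\<lambda>x y. f (inv S y) (inv S x))"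
proof -
  have "cbilinear (\<lambda>x y. f (inv S y) (inv S x))"
    by (intro cbilinearI clinear_bilinear_left[OF f] clinear_bilinear_right[OF f]
        inverse_antipode_linear)
  from sweedler_antipode[OF this, of "inv S h"] show ?thesis by simp
qed

text \<open>Applying \<open>S\<^sup>-\<^sup>1\<close> to \<open>h\<^sub>1 S(h\<^sub>2) = \<epsilon>(h)\<close> reverses the factors, which is why the indices in
  \<open>h\<^sub>2 S\<^sup>-\<^sup>1(h\<^sub>1) = \<epsilon>(h)\<close> are interchanged compared with the antipode axiom.\<close>

lemma sweedler_inverse_antipode_cancel:
  assumes "clinear f"
  shows "sweedler (\<Delta> h) (\<lambda>x y. f (y * inv S x)) = \<epsilon> h *\<^sub>C f 1"
proof -
  let ?g = "\<lambda>z. f (inv S z)"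
  have "clinear ?g" by (intro clinear_comp[OF assms] inverse_antipode_linear)
  from sweedler_antipode_right[OF this, of h] show ?thesis
    using antipode_one S_inv_S[of 1] by (simp add: inverse_antipode_mult)
qed

end

end


section \<open>The diagonal action on tensor powers\<close>

text \<open>The product of the tensor algebra. It makes splitting off the last letter of a word a bilinear
  operation, as \<^const>\<open>tensor_cons\<close> does for the first letter.\<close>

definition tensor_append ::
    "'a::complex_vector tensor_algebra \<Rightarrow> 'a tensor_algebra \<Rightarrow> 'a tensor_algebra"
  where "tensor_append x y = multi_lift (\<lambda>as. multi_lift (\<lambda>bs. pure_tensor (as @ bs)) y) x"

lemma clinear_multi_lift_param:
  assumes mul: "\<And>x. multilinear (g x)" and lin: "\<And>as. clinear (\<lambda>x. g x as)"
  shows "clinear (\<lambda>x. multi_lift (g x) y)"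
proof (rule clinearI)
  note L = clinear_multi_lift[OF mul] and P = multi_lift_pure[OF mul]
  have "multi_lift (g (u + v)) = (\<lambda>y. multi_lift (g u) y + multi_lift (g v) y)" for u v
    by (rule tensor_algebra_eqI[OF L])
      (auto intro!: clinearI simp: P clinear_add[OF L] clinear_scaleC[OF L] clinear_add[OF lin]
        scaleC_add_right algebra_simps)
  then show "multi_lift (g (u + v)) y = multi_lift (g u) y + multi_lift (g v) y" for u v by simp
  have "multi_lift (g (c *\<^sub>C u)) = (\<lambda>y. c *\<^sub>C multi_lift (g u) y)" for c u
    by (rule tensor_algebra_eqI[OF L])
      (auto intro!: clinearI simp: P clinear_add[OF L] clinear_scaleC[OF L] clinear_scaleC[OF lin]
        scaleC_add_right scaleC_scaleC mult.commute)
  then show "multi_lift (g (c *\<^sub>C u)) y = c *\<^sub>C multi_lift (g u) y" for c u by simp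
qed

lemma multilinear_append_left: "multilinear (\<lambda>bs. pure_tensor (as @ bs))"
  using multilinear_pure_tensor unfolding multilinear_def append_assoc[symmetric] by blast

lemma multilinear_append_right: "multilinear (\<lambda>as. multi_lift (\<lambda>bs. pure_tensor (as @ bs)) y)"
proof -
  have "clinear (\<lambda>a. pure_tensor ((xs @ a # ys) @ bs))" for xs ys bs :: "'a list"
    using multilinear_pure_tensor unfolding multilinear_def append_assoc append_Cons by blast
  then show ?thesis
    unfolding multilinear_def
    by (intro allI clinear_multi_lift_param multilinear_append_left)
qed

lemma tensor_append_pure: "tensor_append (pure_tensor as) (pure_tensor bs) = pure_tensor (as @ bs)"
  unfolding tensor_append_def multi_lift_pure[OF multilinear_append_right]
  by (rule multi_lift_pure[OF multilinear_append_left])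

lemma cbilinear_tensor_append: "cbilinear tensor_append"
  unfolding tensor_append_def
  by (intro cbilinearI clinear_multi_lift clinear_multi_lift_param multilinear_append_left
      multilinear_append_right)

lemmas tensor_linear_intros = 
  clinear_bilinear_left[OF cbilinear_tensor_append] clinear_bilinear_right[OF cbilinear_tensor_append]

lemma tensor_append_cons: "tensor_append (tensor_cons a x) y = tensor_cons a (tensor_append x y)"
proof -
  have "(\<lambda>y. tensor_append (tensor_cons a (pure_tensor as)) y) =
      (\<lambda>y. tensor_cons a (tensor_append (pure_tensor as) y))" for as
    by (rule tensor_algebra_eqI)
      (intro linear_intros tensor_linear_intros | simp add: tensor_cons_pure tensor_append_pure)+
  then have "(\<lambda>x. tensor_append (tensor_cons a x) y) = (\<lambda>x. tensor_cons a (tensor_append x y))"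
    by (intro tensor_algebra_eqI linear_intros tensor_linear_intros) metis
  then show ?thesis by metis
qed

lemma tensor_append_Nil: "tensor_append (pure_tensor []) y = y"
proof -
  have "(\<lambda>y. tensor_append (pure_tensor []) y) = (\<lambda>y. y)"
    by (rule tensor_algebra_eqI)
      (intro linear_intros tensor_linear_intros | simp add: tensor_append_pure)+
  then show ?thesis by metis
qed

lemma tensor_append_Nil_right: "tensor_append x (pure_tensor []) = x"
proof -
  have "(\<lambda>x. tensor_append x (pure_tensor [])) = (\<lambda>x. x)"
    by (rule tensor_algebra_eqI)
      (intro linear_intros tensor_linear_intros | simp add: tensor_append_pure)+
  then show ?thesis by metis
qed

lemma tensor_append_assoc:
  "tensor_append (tensor_append x y) z = tensor_append x (tensor_append y z)"
proof -
  have "(\<lambda>x. tensor_append (tensor_append x y) z) = (\<lambda>x. tensor_append x (tensor_append y z))"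
  proof (intro tensor_algebra_eqI linear_intros tensor_linear_intros)
    show "tensor_append (tensor_append (pure_tensor as) y) z =
        tensor_append (pure_tensor as) (tensor_append y z)" for as
      by (induct as) (simp_all add: tensor_append_Nil tensor_append_cons flip: tensor_cons_pure)
  qed
  then show ?thesis by metis
qed

lemma subspace_tensor_power: "complex_vector.subspace (tensor_power n)"
  by (simp add: tensor_power_def)

lemma pure_in_tensor_power: "length as = n \<Longrightarrow> pure_tensor as \<in> tensor_power n"
  unfolding tensor_power_def by (blast intro: complex_vector.span_base)

lemma tensor_power_eqI:
  assumes "clinear F" "clinear G" "x \<in> tensor_power n"
    and "\<And>as. length as = n \<Longrightarrow> F (pure_tensor as) = G (pure_tensor as)"
  shows "F x = G x"
  by (rule clinear_span_eq[OF assms(1,2) _ assms(3)[unfolded tensor_power_def]]) (use assms(4) in auto)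

lemma tensor_cons_in_tensor_power:
  assumes "x \<in> tensor_power n" shows "tensor_cons a x \<in> tensor_power (Suc n)"
  using assms unfolding tensor_power_def[of n]
proof (induct rule: complex_vector.span_induct_alt)
  note L = clinear_right[OF cbilinear_tensor_cons, of a]
  note S = subspace_tensor_power[of "Suc n", where 'a = 'a]
  case base then show ?case using S by (simp add: clinear_0[OF L] complex_vector.subspace_0)
  case (step c x y) then show ?case
    using S by (auto simp: clinear_add[OF L] clinear_scaleC[OF L] tensor_cons_pure
      intro!: complex_vector.subspace_add complex_vector.subspace_scale pure_in_tensor_power)
qed

context left_module_algebra
begin

lemma clinear_diag: "clinear (diag h)"
  unfolding diag_def by (intro clinear_multi_lift multilinear_diag_list)

lemma cbilinear_diag: "cbilinear diag"
  unfolding diag_def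
  by (intro cbilinearI clinear_multi_lift clinear_multi_lift_param multilinear_diag_list
      clinear_diag_list)

lemmas diag_linear_intros = hopf_linear_intros tensor_linear_intros
  clinear_bilinear_left[OF act_bilinear] clinear_bilinear_right[OF act_bilinear]
  clinear_bilinear_left[OF cbilinear_diag] clinear_bilinear_right[OF cbilinear_diag]
  clinear_comp[OF clinear_diag_list]

lemma diag_cons:
  "diag h (tensor_cons a x) = sweedler (\<Delta> h) (\<lambda>h1 h2. tensor_cons (h1 \<rhd> a) (diag h2 x))"
proof -
  have "(\<lambda>x. diag h (tensor_cons a x)) =
      (\<lambda>x. sweedler (\<Delta> h) (\<lambda>h1 h2. tensor_cons (h1 \<rhd> a) (diag h2 x)))"
    by (rule tensor_algebra_eqI)
      (intro diag_linear_intros | simp add: tensor_cons_pure diag_pure)+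
  then show ?thesis by metis
qed

lemma diag_list_in_tensor_power: "diag_list h as \<in> tensor_power (length as)"
proof (induct as arbitrary: h)
  case Nil
  then show ?case
    by (simp add: complex_vector.subspace_scale[OF subspace_tensor_power] pure_in_tensor_power)
next
  case (Cons a as)
  have "cbilinear (\<lambda>h1 h2. tensor_cons (h1 \<rhd> a) (diag_list h2 as))"
    by (intro diag_linear_intros)
  then show ?case
    using Cons by (simp add: sweedler_in_subspace[OF subspace_tensor_power] tensor_cons_in_tensor_power)
qed

lemma diag_mult: "diag (h * k) x = diag h (diag k x)"
proof -
  have "diag_list (h * k) as = diag h (diag_list k as)" for as
  proof (induct as arbitrary: h k)
    case Nil
    then show ?case
      by (simp add: \<epsilon>_mult clinear_scaleC[OF clinear_diag] diag_pure scaleC_scaleC mult.commute)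
  next
    case (Cons a as)
    have "diag_list (h * k) (a # as) = sweedler (\<Delta> h) (\<lambda>h1 h2. sweedler (\<Delta> k) (\<lambda>k1 k2.
        tensor_cons ((h1 * k1) \<rhd> a) (diag_list (h2 * k2) as)))"
      unfolding diag_list.simps by (intro sweedler_mult diag_linear_intros)
    also have "\<dots> = sweedler (\<Delta> k) (\<lambda>k1 k2. sweedler (\<Delta> h) (\<lambda>h1 h2.
        tensor_cons ((h1 * k1) \<rhd> a) (diag_list (h2 * k2) as)))"
      by (intro sweedler_swap diag_linear_intros)
    also have "\<dots> = sweedler (\<Delta> k) (\<lambda>k1 k2. diag h (tensor_cons (k1 \<rhd> a) (diag_list k2 as)))"
      by (simp add: diag_cons Cons act_mult)
    also have "\<dots> = diag h (diag_list k (a # as))"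
      unfolding diag_list.simps by (intro linear_sweedler[symmetric] clinear_diag diag_linear_intros)
    finally show ?case .
  qed
  then have "diag (h * k) = (\<lambda>x. diag h (diag k x))"
    by (intro tensor_algebra_eqI clinear_diag diag_linear_intros) (simp add: diag_pure)
  then show ?thesis by simp
qed

lemma diag_one: "diag 1 x = x"
proof -
  have "diag_list 1 as = pure_tensor as" for as
  proof (induct as)
    case (Cons a as)
    have "cbilinear (\<lambda>h1 h2. tensor_cons (h1 \<rhd> a) (diag_list h2 as))"
      by (intro diag_linear_intros)
    then show ?case by (simp add: \<Delta>_one tensor_lift_pure Cons act_one tensor_cons_pure)
  qed (simp add: \<epsilon>_one scaleC_one)
  then have "diag 1 = (\<lambda>x. x)"
    by (intro tensor_algebra_eqI clinear_diag diag_linear_intros) (simp add: diag_pure)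
  then show ?thesis by simp
qed

text \<open>The recursion of \<^const>\<open>left_module_algebra.diag_list\<close> peels letters from the left, but the cyclic operator takes
  the last one; by coassociativity the letters can be peeled from the right as well.\<close>

lemma diag_list_snoc:
  "diag_list h (as @ [a]) =
    sweedler (\<Delta> h) (\<lambda>h1 h2. tensor_append (diag_list h1 as) (tensor_cons (h2 \<rhd> a) (pure_tensor [])))"
proof (induct as arbitrary: h)
  case Nil
  let ?e = "pure_tensor [] :: 'a tensor_algebra"
  have "diag_list h [a] = sweedler (\<Delta> h) (\<lambda>h1 h2. \<epsilon> h2 *\<^sub>C tensor_cons (h1 \<rhd> a) ?e)"
    by (simp add: clinear_scaleC[OF clinear_right[OF cbilinear_tensor_cons]])
  also have "\<dots> = tensor_cons (h \<rhd> a) ?e"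
    by (rule sweedler_counit_right) (intro diag_linear_intros)
  also have "\<dots> = sweedler (\<Delta> h) (\<lambda>h1 h2. \<epsilon> h1 *\<^sub>C tensor_cons (h2 \<rhd> a) ?e)"
    by (rule sweedler_counit_left[symmetric]) (intro diag_linear_intros)
  finally show ?case
    by (simp add: clinear_scaleC[OF clinear_left[OF cbilinear_tensor_append]] tensor_append_Nil)
next
  case (Cons b as)
  let ?e = "pure_tensor [] :: 'a tensor_algebra"
  have "diag_list h ((b # as) @ [a]) = sweedler (\<Delta> h) (\<lambda>h1 h'. sweedler (\<Delta> h') (\<lambda>h2 h3.
      tensor_cons (h1 \<rhd> b) (tensor_append (diag_list h2 as) (tensor_cons (h3 \<rhd> a) ?e))))"
    unfolding append_Cons diag_list.simps Cons
    by (intro sweedler_cong linear_sweedler diag_linear_intros clinear_right[OF cbilinear_tensor_cons])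
  also have "\<dots> = sweedler (\<Delta> h) (\<lambda>h' h3. sweedler (\<Delta> h') (\<lambda>h1 h2.
      tensor_cons (h1 \<rhd> b) (tensor_append (diag_list h2 as) (tensor_cons (h3 \<rhd> a) ?e))))"
    by (intro sweedler_coassoc[symmetric] diag_linear_intros)
  also have "\<dots> = sweedler (\<Delta> h) (\<lambda>h' h3.
      tensor_append (diag_list h' (b # as)) (tensor_cons (h3 \<rhd> a) ?e))"
    unfolding diag_list.simps tensor_append_cons[symmetric]
    by (intro sweedler_cong linear_sweedler[symmetric] diag_linear_intros
        clinear_left[OF cbilinear_tensor_append])
  finally show ?case .
qed

text \<open>Because \<open>h (a b) = (h\<^sub>1 a) (h\<^sub>2 b)\<close>, multiplying two adjacent factors commutes with the diagonal
  action. Here \<open>F\<close> stands for a coface of \<open>G\<close>, known only through its values on words. The induction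
  absorbs the letters in front of the product into \<open>F\<close> and \<open>G\<close>.\<close>

lemma diag_list_multiply:
  assumes "clinear F" "clinear G"
    and "\<And>xs' a b ys'. length xs' = length xs \<Longrightarrow> length ys' = length ys \<Longrightarrow>
      F (pure_tensor (xs' @ a # b # ys')) = G (pure_tensor (xs' @ (a * b) # ys'))"
  shows "F (diag_list h (xs @ a # b # ys)) = G (diag_list h (xs @ (a * b) # ys))"
  using assms
proof (induct xs arbitrary: F G h)
  case Nil
  note intros = diag_linear_intros clinear_comp[OF Nil(1)] clinear_comp[OF Nil(2)]
  have eq: "F (tensor_cons c (tensor_cons d y)) = G (tensor_cons (c * d) y)"
    if "y \<in> tensor_power (length ys)" for c d y
    by (rule tensor_power_eqI[OF _ _ that]) (intro intros | simp add: tensor_cons_pure Nil(3)[of "[]", simplified])+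
  have "F (diag_list h (a # b # ys)) = sweedler (\<Delta> h) (\<lambda>h1 h'. sweedler (\<Delta> h') (\<lambda>h2 h3.
      F (tensor_cons (h1 \<rhd> a) (tensor_cons (h2 \<rhd> b) (diag_list h3 ys)))))"
    unfolding diag_list.simps
    by (subst linear_sweedler[OF Nil(1)], intro intros,
      intro sweedler_cong linear_sweedler intros)
  also have "\<dots> = sweedler (\<Delta> h) (\<lambda>h1 h'. sweedler (\<Delta> h') (\<lambda>h2 h3.
      G (tensor_cons ((h1 \<rhd> a) * (h2 \<rhd> b)) (diag_list h3 ys))))"
    by (simp add: eq diag_list_in_tensor_power)
  also have "\<dots> = sweedler (\<Delta> h) (\<lambda>h' h3. sweedler (\<Delta> h') (\<lambda>h1 h2.
      G (tensor_cons ((h1 \<rhd> a) * (h2 \<rhd> b)) (diag_list h3 ys))))"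
    by (intro sweedler_coassoc[symmetric] intros)
  also have "\<dots> = sweedler (\<Delta> h) (\<lambda>h' h3. G (tensor_cons (h' \<rhd> (a * b)) (diag_list h3 ys)))"
    unfolding act_prod by (intro sweedler_cong linear_sweedler[symmetric] intros)
  also have "\<dots> = G (diag_list h ((a * b) # ys))"
    unfolding diag_list.simps by (intro linear_sweedler[symmetric] Nil intros)
  finally show ?case by simp
next
  case (Cons x xs)
  note intros = diag_linear_intros clinear_comp[OF Cons(2)] clinear_comp[OF Cons(3)]
  have "F (tensor_cons c (diag_list k (xs @ a # b # ys))) =
      G (tensor_cons c (diag_list k (xs @ (a * b) # ys)))" for c k
  proof (rule Cons(1))
    fix xs' ys' :: "'a list" and a b :: 'a
    assume "length xs' = length xs" "length ys' = length ys"
    then show "F (tensor_cons c (pure_tensor (xs' @ a # b # ys'))) =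
        G (tensor_cons c (pure_tensor (xs' @ (a * b) # ys')))"
      using Cons(4)[of "c # xs'" ys' a b] by (simp add: tensor_cons_pure)
  qed (intro intros)+
  then show ?case
    by (simp add: linear_sweedler[OF Cons(2)] linear_sweedler[OF Cons(3)] diag_linear_intros)
qed

text \<open>Because \<open>h 1 = \<epsilon>(h) 1\<close>, inserting a unit commutes with the diagonal action; \<open>G\<close> stands for a
  codegeneracy of \<open>F\<close>.\<close>

lemma diag_list_unit:
  assumes "clinear F" "clinear G"
    and "\<And>xs' ys'. length xs' = length xs \<Longrightarrow> length ys' = length ys \<Longrightarrow>
      F (pure_tensor (xs' @ 1 # ys')) = G (pure_tensor (xs' @ ys'))"
  shows "F (diag_list h (xs @ 1 # ys)) = G (diag_list h (xs @ ys))"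
  using assms
proof (induct xs arbitrary: F G h)
  case Nil
  note intros = diag_linear_intros clinear_comp[OF Nil(1)] clinear_comp[OF Nil(2)]
  have eq: "F (tensor_cons 1 y) = G y" if "y \<in> tensor_power (length ys)" for y
    by (rule tensor_power_eqI[OF _ Nil(2) that]) (intro intros | simp add: tensor_cons_pure Nil(3)[of "[]", simplified])+
  have "diag_list h (1 # ys) = sweedler (\<Delta> h) (\<lambda>h1 h2. \<epsilon> h1 *\<^sub>C tensor_cons 1 (diag_list h2 ys))"
    by (simp add: act_unit clinear_scaleC[OF clinear_left[OF cbilinear_tensor_cons]])
  also have "\<dots> = tensor_cons 1 (diag_list h ys)"
    by (rule sweedler_counit_left) (intro intros clinear_diag_list)
  finally show ?case by (simp add: eq diag_list_in_tensor_power)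
next
  case (Cons x xs)
  note intros = diag_linear_intros clinear_comp[OF Cons(2)] clinear_comp[OF Cons(3)]
  have "F (tensor_cons c (diag_list k (xs @ 1 # ys))) = G (tensor_cons c (diag_list k (xs @ ys)))" for c k
  proof (rule Cons(1))
    fix xs' ys' :: "'a list"
    assume "length xs' = length xs" "length ys' = length ys"
    then show "F (tensor_cons c (pure_tensor (xs' @ 1 # ys'))) = G (tensor_cons c (pure_tensor (xs' @ ys')))"
      using Cons(4)[of "c # xs'" ys'] by (simp add: tensor_cons_pure)
  qed (intro intros)+
  then show ?case
    by (simp add: linear_sweedler[OF Cons(2)] linear_sweedler[OF Cons(3)] diag_linear_intros)
qed

end


section \<open>Words with one product formed or one unit inserted\<close>

definition multiply_at :: "nat \<Rightarrow> 'a::monoid_mult list \<Rightarrow> 'a list"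
  where "multiply_at i as = take i as @ (as ! i * as ! (i + 1)) # drop (i + 2) as"

definition insert_unit :: "nat \<Rightarrow> 'a::monoid_mult list \<Rightarrow> 'a list"
  where "insert_unit i as = take i as @ 1 # drop i as"

lemma multiply_at_simps [simp]:
  "multiply_at 0 (a # b # as) = (a * b) # as"
  "multiply_at (Suc i) (a # as) = a # multiply_at i as"
  by (simp_all add: multiply_at_def)

lemma insert_unit_simps [simp]:
  "insert_unit 0 as = 1 # as"
  "insert_unit (Suc i) (a # as) = a # insert_unit i as"
  by (simp_all add: insert_unit_def)

lemma length_multiply_at: "i + 1 < length as \<Longrightarrow> length (multiply_at i as) = length as - 1"
  by (simp add: multiply_at_def)

lemma length_insert_unit [simp]: "length (insert_unit i as) = Suc (length as)"
  by (simp add: insert_unit_def)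

lemma multiply_at_append: "i + 1 < length as \<Longrightarrow> multiply_at i (as @ bs) = multiply_at i as @ bs"
  by (simp add: multiply_at_def nth_append)

lemma multiply_at_last: "multiply_at (length as) (as @ [a, b]) = as @ [a * b]"
  by (simp add: multiply_at_def nth_append)

lemma insert_unit_append: "i \<le> length as \<Longrightarrow> insert_unit i (as @ bs) = insert_unit i as @ bs"
  by (simp add: insert_unit_def)

lemma insert_unit_length: "insert_unit (length as) as = as @ [1]"
  by (simp add: insert_unit_def)

lemma multiply_at_multiply_at:
  "i \<le> j \<Longrightarrow> j + 2 < length as \<Longrightarrow>
    multiply_at i (multiply_at (Suc j) as) = multiply_at j (multiply_at i as)"
proof (induct i arbitrary: j as)
  case 0
  then obtain a b c cs where "as = a # b # c # cs"
    by (cases as; cases "tl as"; cases "tl (tl as)") auto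
  then show ?case by (cases j) (simp_all add: mult.assoc)
next
  case (Suc i)
  then obtain j' a bs where "j = Suc j'" "as = a # bs" by (cases j; cases as) auto
  with Suc show ?case by simp
qed

lemma insert_unit_insert_unit:
  "i \<le> j \<Longrightarrow> j \<le> length as \<Longrightarrow>
    insert_unit i (insert_unit j as) = insert_unit (Suc j) (insert_unit i as)"
proof (induct i arbitrary: j as)
  case (Suc i)
  then obtain j' a bs where "j = Suc j'" "as = a # bs" by (cases j; cases as) auto
  with Suc show ?case by simp
qed simp

lemma multiply_at_insert_unit_greater:
  "i < j \<Longrightarrow> j < length as \<Longrightarrow>
    multiply_at i (insert_unit (Suc j) as) = insert_unit j (multiply_at i as)"
proof (induct i arbitrary: j as)
  case 0
  then obtain j' a b bs where "j = Suc j'" "as = a # b # bs" by (cases j; cases as; cases "tl as") auto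
  then show ?case by simp
next
  case (Suc i)
  then obtain j' a bs where "j = Suc j'" "as = a # bs" by (cases j; cases as) auto
  with Suc show ?case by simp
qed

lemma multiply_at_insert_unit_Suc: "i < length as \<Longrightarrow> multiply_at i (insert_unit (Suc i) as) = as"
  by (simp add: multiply_at_def insert_unit_def nth_append id_take_nth_drop[symmetric])

lemma multiply_at_insert_unit: "i < length as \<Longrightarrow> multiply_at i (insert_unit i as) = as"
  by (simp add: multiply_at_def insert_unit_def nth_append id_take_nth_drop[symmetric])

lemma multiply_at_insert_unit_less:
  "j \<le> i \<Longrightarrow> i + 1 < length as \<Longrightarrow>
    multiply_at (Suc i) (insert_unit j as) = insert_unit j (multiply_at i as)"
proof (induct j arbitrary: i as)
  case (Suc j)
  then obtain i' a bs where "i = Suc i'" "as = a # bs" by (cases i; cases as) auto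
  with Suc show ?case by simp
qed simp


section \<open>Functionals and cochains\<close>

lemma tensor_power_in_coeff_tensor: "x \<in> tensor_power (n + 1) \<Longrightarrow> m \<otimes> x \<in> coeff_tensor n"
  unfolding coeff_tensor_def by (blast intro: complex_vector.span_base)

lemma subspace_coeff_tensor: "complex_vector.subspace (coeff_tensor n)"
  by (simp add: coeff_tensor_def)

lemma subspace_functionals: "complex_vector.subspace V \<Longrightarrow> complex_vector.subspace (functionals V)"
  by (rule complex_vector.subspaceI)
    (auto simp: functionals_def clinear_on_def scaleC_fun_def scaleC_complex_def algebra_simps)

lemma functionals_add:
  "complex_vector.subspace V \<Longrightarrow> f \<in> functionals V \<Longrightarrow> g \<in> functionals V \<Longrightarrow> f + g \<in> functionals V"
  by (intro complex_vector.subspace_add subspace_functionals)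

lemma functionals_scaleC:
  "complex_vector.subspace V \<Longrightarrow> f \<in> functionals V \<Longrightarrow> c *\<^sub>C f \<in> functionals V"
  by (intro complex_vector.subspace_scale subspace_functionals)

lemma scaleC_apply: "(c *\<^sub>C f) x = c *\<^sub>C f x"
  by (simp add: scaleC_fun_def)

context AH_module_comodule
begin

text \<open>A functional is linear only on \<^term>\<open>coeff_tensor n\<close>, whereas the rules for Sweedler sums apply to
  maps that are linear everywhere. The extension vanishes on words of any length other than \<open>n + 1\<close>.\<close>

lemma functional_extension:
  assumes f: "f \<in> functionals (coeff_tensor n :: ('m \<otimes> 'a tensor_algebra) set)"
  obtains F :: "'m \<otimes> 'a tensor_algebra \<Rightarrow> complex"
  where "clinear F" and "\<And>x. x \<in> coeff_tensor n \<Longrightarrow> f x = F x"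
proof -
  let ?g = "\<lambda>m as. if length as = Suc n then f (m \<otimes> pure_tensor as) else 0"
  have 0: "clinear (\<lambda>x::'a. 0::complex)" by (simp add: clinear_iff)
  have mul: "multilinear (?g m)" for m
    unfolding multilinear_def
  proof (intro allI)
    show "clinear (\<lambda>a. ?g m (xs @ a # ys))" for xs ys
      using functional_clinear_slot[OF f] 0 by (cases "length xs + length ys = n") simp_all
  qed
  have lin: "clinear (\<lambda>m. ?g m as)" for as
    using functional_clinear_coeff[OF f] by (auto simp: clinear_iff)
  let ?F = "tensor_lift (\<lambda>m. multi_lift (?g m))"
  have bil: "cbilinear (\<lambda>m. multi_lift (?g m))"
    by (intro cbilinearI clinear_multi_lift clinear_multi_lift_param mul lin)
  have L: "clinear ?F" by (rule clinear_tensor_lift[OF bil])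
  let ?F' = "\<lambda>x. if x \<in> coeff_tensor n then ?F x else 0"
  have "f = ?F'"
  proof (rule functionals_eqI[OF f])
    show "?F' \<in> functionals (coeff_tensor n)"
      by (auto simp: functionals_def clinear_on_def clinear_add[OF L] clinear_scaleC[OF L]
          coeff_tensor_def complex_vector.span_add complex_vector.span_scale)
  qed (simp add: pure_in_coeff_tensor tensor_lift_pure[OF bil] multi_lift_pure[OF mul])
  then have "f x = ?F x" if "x \<in> coeff_tensor n" for x
    using that by (simp add: fun_eq_iff[of f])
  with L show ?thesis by (rule that)
qed

lemmas coefficient_linear_intros = diag_linear_intros clinear_comp[OF \<rho>_linear]
  clinear_bilinear_left[OF ract_bilinear] clinear_bilinear_right[OF ract_bilinear]

lemmas sweedler_coaction = sweedler_assoc[OF \<rho>_coassoc \<Delta>_linear \<rho>_linear]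

lemma sweedler_coaction_counit:
  assumes "clinear f" shows "sweedler (\<rho> m) (\<lambda>h m'. \<epsilon> h *\<^sub>C f m') = f m"
proof -
  have "f (sweedler (\<rho> m) (\<lambda>h m'. \<epsilon> h *\<^sub>C m')) = sweedler (\<rho> m) (\<lambda>h m'. f (\<epsilon> h *\<^sub>C m'))"
    by (intro linear_sweedler assms coefficient_linear_intros)
  then show ?thesis by (simp add: \<rho>_counit clinear_scaleC[OF assms])
qed

lemma clinear_tensor_ract: "clinear (\<lambda>x. tensor_ract x h)"
  unfolding tensor_ract_def by (intro coefficient_linear_intros)

lemma tensor_ract_pure:
  "tensor_ract (m \<otimes> x) h = sweedler (\<Delta> h) (\<lambda>h1 h2. (m \<lhd> h1) \<otimes> diag (S h2) x)"
  unfolding tensor_ract_def by (subst tensor_lift_pure) (intro coefficient_linear_intros, rule refl)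

lemma diag_in_tensor_power:
  assumes "x \<in> tensor_power n" shows "diag h x \<in> tensor_power n"
  using assms unfolding tensor_power_def[of n]
proof (induct rule: complex_vector.span_induct_alt)
  note L = clinear_diag[of h] and S = subspace_tensor_power[of n, where 'a = 'a]
  case base then show ?case
    using complex_vector.span_zero by (simp add: clinear_0[OF L])
  case (step c x y)
  then have "diag h x \<in> tensor_power n" by (auto simp: diag_pure diag_list_in_tensor_power)
  with step(2) show ?case
    by (simp add: clinear_add[OF L] clinear_scaleC[OF L] tensor_power_def
        complex_vector.span_add complex_vector.span_scale)
qed

lemma tensor_ract_in_coeff_tensor:
  assumes "x \<in> coeff_tensor n" shows "tensor_ract x h \<in> coeff_tensor n"
  using assms unfolding coeff_tensor_def
proof (induct rule: complex_vector.span_induct_alt)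
  note L = clinear_tensor_ract[of h]
  case base then show ?case
    using complex_vector.span_zero by (simp add: clinear_0[OF L])
  case (step c x y)
  then obtain m z where x: "x = m \<otimes> z" and z: "z \<in> tensor_power (n + 1)" by blast
  have "tensor_ract x h \<in> coeff_tensor n"
    unfolding x tensor_ract_pure
  proof (rule sweedler_in_subspace[OF subspace_coeff_tensor])
    show "cbilinear (\<lambda>h1 h2. (m \<lhd> h1) \<otimes> diag (S h2) z)" by (intro coefficient_linear_intros)
  qed (intro tensor_power_in_coeff_tensor diag_in_tensor_power z)
  with step(2) show ?case
    by (simp add: clinear_add[OF L] clinear_scaleC[OF L] coeff_tensor_def
        complex_vector.span_add complex_vector.span_scale)
qed

text \<open>If \<open>f\<close> is \<open>H\<close>-linear, then
  \<open>f (m h \<otimes> x) = f (m h\<^sub>1 \<otimes> S(h\<^sub>2) h\<^sub>3 x) = f ((m \<otimes> h\<^sub>2 x) h\<^sub>1) = f (m \<otimes> h x)\<close>. Conversely, the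
  condition gives \<open>f ((m \<otimes> x) h) = f (m h\<^sub>1 \<otimes> S(h\<^sub>2) x) = f (m \<otimes> h\<^sub>1 S(h\<^sub>2) x) = \<epsilon>(h) f (m \<otimes> x)\<close>.\<close>

lemma cochains_iff:
  "f \<in> cochains n \<longleftrightarrow> f \<in> functionals (coeff_tensor n) \<and>
    (\<forall>m h as. length as = n + 1 \<longrightarrow> f ((m \<lhd> h) \<otimes> pure_tensor as) = f (m \<otimes> diag_list h as))"
    (is "_ \<longleftrightarrow> ?V \<and> ?hom")
proof (cases ?V)
  case True
  obtain F where F: "clinear F" and fF: "\<And>x. x \<in> coeff_tensor n \<Longrightarrow> f x = F x"
    by (rule functional_extension[OF True]) blast
  note intros = coefficient_linear_intros clinear_comp[OF F]
  have pure: "f (m \<otimes> x) = F (m \<otimes> x)" if "x \<in> tensor_power (n + 1)" for m x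
    using that by (intro fF tensor_power_in_coeff_tensor)
  have ract: "F (tensor_ract (m \<otimes> x) h) = sweedler (\<Delta> h) (\<lambda>h1 h2. F ((m \<lhd> h1) \<otimes> diag (S h2) x))"
    for m x h
    unfolding tensor_ract_pure by (intro linear_sweedler F coefficient_linear_intros)
  have "f ((m \<lhd> h) \<otimes> pure_tensor as) = f (m \<otimes> diag_list h as)"
    if inv: "\<And>x h. x \<in> coeff_tensor n \<Longrightarrow> f (tensor_ract x h) = \<epsilon> h * f x" and len: "length as = n + 1"
    for m h as
  proof -
    let ?x = "pure_tensor as"
    have x: "diag h' ?x \<in> tensor_power (n + 1)" for h'
      using len by (intro diag_in_tensor_power pure_in_tensor_power)
    have "F ((m \<lhd> h) \<otimes> ?x) = sweedler (\<Delta> h) (\<lambda>h1 h'. \<epsilon> h' *\<^sub>C F ((m \<lhd> h1) \<otimes> diag 1 ?x))"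
      unfolding diag_one by (intro sweedler_counit_right[symmetric] intros)
    also have "\<dots> = sweedler (\<Delta> h) (\<lambda>h1 h'. sweedler (\<Delta> h') (\<lambda>h2 h3.
        F ((m \<lhd> h1) \<otimes> diag (S h2 * h3) ?x)))"
      by (intro sweedler_cong sweedler_antipode_left[symmetric] intros)
    also have "\<dots> = sweedler (\<Delta> h) (\<lambda>h' h3. sweedler (\<Delta> h') (\<lambda>h1 h2.
        F ((m \<lhd> h1) \<otimes> diag (S h2 * h3) ?x)))"
      by (intro sweedler_coassoc[symmetric] intros)
    also have "\<dots> = sweedler (\<Delta> h) (\<lambda>h' h3. F (tensor_ract (m \<otimes> diag h3 ?x) h'))"
      by (simp add: ract diag_mult)
    also have "\<dots> = sweedler (\<Delta> h) (\<lambda>h' h3. \<epsilon> h' *\<^sub>C F (m \<otimes> diag h3 ?x))"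
    proof (rule sweedler_cong)
      fix h' h3
      have "m \<otimes> diag h3 ?x \<in> coeff_tensor n" by (rule tensor_power_in_coeff_tensor[OF x])
      then show "F (tensor_ract (m \<otimes> diag h3 ?x) h') = \<epsilon> h' *\<^sub>C F (m \<otimes> diag h3 ?x)"
        using inv fF tensor_ract_in_coeff_tensor by (metis scaleC_complex_def)
    qed
    also have "\<dots> = F (m \<otimes> diag h ?x)"
      by (intro sweedler_counit_left intros)
    finally show ?thesis
      by (simp add: pure[OF pure_in_tensor_power[OF len]] pure[OF x[of h, unfolded diag_pure]] diag_pure)
  qed
  then have 1: "?hom" if "f \<in> cochains n"
    using that by (simp add: cochains_def)
  have "f (tensor_ract x h) = \<epsilon> h * f x" if hom: ?hom and x: "x \<in> coeff_tensor n" for x h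
  proof -
    have hom': "F ((m \<lhd> h) \<otimes> x) = F (m \<otimes> diag h x)" if "x \<in> tensor_power (n + 1)" for m h x
    proof (rule tensor_power_eqI[OF _ _ that])
      fix as :: "'a list" assume len: "length as = n + 1"
      then have "diag_list h as \<in> tensor_power (n + 1)" by (metis diag_list_in_tensor_power)
      then show "F ((m \<lhd> h) \<otimes> pure_tensor as) = F (m \<otimes> diag h (pure_tensor as))"
        using hom len by (simp add: diag_pure pure_in_tensor_power flip: pure)
    qed (intro intros)+
    have "F (tensor_ract x h) = \<epsilon> h *\<^sub>C F x"
    proof (rule clinear_span_eq[OF _ _ _ x[unfolded coeff_tensor_def]])
      show "clinear (\<lambda>x. F (tensor_ract x h))" by (intro clinear_comp[OF F] clinear_tensor_ract)
      show "clinear (\<lambda>x. \<epsilon> h *\<^sub>C F x)" by (intro intros)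
      fix y :: "'m \<otimes> 'a tensor_algebra" assume "y \<in> {m \<otimes> x | (m::'m) x. x \<in> tensor_power (n + 1)}"
      then obtain m z where y: "y = m \<otimes> z" and z: "z \<in> tensor_power (n + 1)" by blast
      have "F (tensor_ract y h) = sweedler (\<Delta> h) (\<lambda>h1 h2. F (m \<otimes> diag (h1 * S h2) z))"
        unfolding y ract diag_mult
        by (intro sweedler_cong hom' diag_in_tensor_power z)
      also have "\<dots> = \<epsilon> h *\<^sub>C F (m \<otimes> diag 1 z)"
        by (intro sweedler_antipode_right intros)
      finally show "F (tensor_ract y h) = \<epsilon> h *\<^sub>C F y" by (simp add: y diag_one)
    qed
    then show ?thesis using x by (simp add: fF tensor_ract_in_coeff_tensor scaleC_complex_def)
  qed
  then have 2: "f \<in> cochains n" if ?hom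
    using that True by (simp add: cochains_def)
  show ?thesis using 1 2 True by metis
qed (simp add: cochains_def)


lemma subspace_cochains: "complex_vector.subspace (cochains n)"
proof (rule complex_vector.subspaceI)
  note V = complex_vector.subspace_0[OF subspace_functionals[OF subspace_coeff_tensor]]
    functionals_add[OF subspace_coeff_tensor] functionals_scaleC[OF subspace_coeff_tensor]
  show "0 \<in> cochains n"
    unfolding cochains_def by (simp add: V)
  show "f + g \<in> cochains n" if "f \<in> cochains n" "g \<in> cochains n" for f g
    using that unfolding cochains_def by (simp add: V distrib_left)
  show "c *\<^sub>C f \<in> cochains n" if "f \<in> cochains n" for c f
    using that unfolding cochains_def by (simp add: V scaleC_apply scaleC_complex_def)
qed


section \<open>The operators on functionals\<close>

abbreviation all_functionals :: "nat \<Rightarrow> ('m \<otimes> 'a tensor_algebra \<Rightarrow> complex) set"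
  where "all_functionals n \<equiv> functionals (coeff_tensor n)"

lemma functional_evaluation_linear:
  assumes f: "f \<in> all_functionals n"
  obtains F where "clinear F"
    and "\<And>m x. x \<in> tensor_power (n + 1) \<Longrightarrow> f (m \<otimes> x) = F (m \<otimes> x)"
    and "\<And>m as. length as = n + 1 \<Longrightarrow> f (m \<otimes> pure_tensor as) = F (m \<otimes> pure_tensor as)"
  using functional_extension[OF f] tensor_power_in_coeff_tensor pure_in_coeff_tensor by metis

lemma functional_pure_linear:
  assumes f: "f \<in> all_functionals n"
  obtains F where "clinear F"
    and "\<And>m as. length as = n + 1 \<Longrightarrow> f (m \<otimes> pure_tensor as) = F (m \<otimes> pure_tensor as)"
  using functional_extension[OF f] pure_in_coeff_tensor by metis

lemma inner_coface_functional:
  "f \<in> all_functionals n \<Longrightarrow> i \<le> n \<Longrightarrow> coface (Suc n) i f \<in> all_functionals (Suc n)"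
  using coface_in[of i "Suc n" f] by simp

lemma codegeneracy_functional:
  "f \<in> all_functionals (Suc n) \<Longrightarrow> i \<le> n \<Longrightarrow> codegeneracy n i f \<in> all_functionals n"
  using codegeneracy_in[of i n f] by simp

lemma inner_coface_pure:
  assumes "f \<in> all_functionals n" "i \<le> n" "length as = Suc (Suc n)"
  shows "coface (Suc n) i f (m \<otimes> pure_tensor as) = f (m \<otimes> pure_tensor (multiply_at i as))"
  using coface_pure[of i "Suc n" f as m] assms by (simp add: multiply_at_def)

lemma codegeneracy_pure_insert:
  assumes "f \<in> all_functionals (Suc n)" "i \<le> n" "length as = Suc n"
  shows "codegeneracy n i f (m \<otimes> pure_tensor as) = f (m \<otimes> pure_tensor (insert_unit (Suc i) as))"
  using codegeneracy_pure[of i n f as m] assms by (simp add: insert_unit_def)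

lemmas inner_operator_simps = inner_coface_functional codegeneracy_functional
  inner_coface_pure codegeneracy_pure_insert length_multiply_at

lemma inner_coface_cochain:
  assumes i: "i \<le> n" and f: "f \<in> cochains n"
  shows "coface (Suc n) i f \<in> cochains (Suc n)"
proof -
  have fV: "f \<in> all_functionals n" using f by (simp add: cochains_iff)
  have dV: "coface (Suc n) i f \<in> all_functionals (Suc n)" by (rule inner_coface_functional[OF fV i])
  have "coface (Suc n) i f ((m \<lhd> h) \<otimes> pure_tensor as) = coface (Suc n) i f (m \<otimes> diag_list h as)"
    if len: "length as = Suc n + 1" for m h as
  proof -
    obtain F where F: "clinear F"
      and fF: "\<And>m x. x \<in> tensor_power (n + 1) \<Longrightarrow> f (m \<otimes> x) = F (m \<otimes> x)"
        "\<And>m as. length as = n + 1 \<Longrightarrow> f (m \<otimes> pure_tensor as) = F (m \<otimes> pure_tensor as)"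
      by (rule functional_evaluation_linear[OF fV]) blast
    obtain D where D: "clinear D"
      and dD: "\<And>m x. x \<in> tensor_power (Suc n + 1) \<Longrightarrow> coface (Suc n) i f (m \<otimes> x) = D (m \<otimes> x)"
        "\<And>m as. length as = Suc n + 1 \<Longrightarrow> coface (Suc n) i f (m \<otimes> pure_tensor as) = D (m \<otimes> pure_tensor as)"
      by (rule functional_evaluation_linear[OF dV]) blast
    have in_power: "diag_list h bs \<in> tensor_power k" if "length bs = k" for bs k
      using that diag_list_in_tensor_power by blast
    let ?xs = "take i as" and ?ys = "drop (i + 2) as"
    have as: "as = ?xs @ as ! i # as ! (i + 1) # ?ys"
      using i len by (simp add: Cons_nth_drop_Suc id_take_nth_drop[symmetric])
    have "coface (Suc n) i f ((m \<lhd> h) \<otimes> pure_tensor as) = f (m \<otimes> diag_list h (multiply_at i as))"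
      using f i len by (simp add: inner_coface_pure[OF fV] cochains_iff length_multiply_at)
    also have "\<dots> = F (m \<otimes> diag_list h (multiply_at i as))"
      using i len by (intro fF in_power) (simp add: length_multiply_at)
    also have "\<dots> = F (m \<otimes> diag_list h (?xs @ (as ! i * as ! (i + 1)) # ?ys))"
      by (simp add: multiply_at_def)
    also have "\<dots> = D (m \<otimes> diag_list h (?xs @ as ! i # as ! (i + 1) # ?ys))"
    proof (rule diag_list_multiply[symmetric])
      fix xs ys :: "'a list" and a b
      assume "length xs = length ?xs" "length ys = length ?ys"
      then have len': "length (xs @ a # b # ys) = Suc n + 1" and xs: "length xs = i"
        using i len by simp_all
      then have "D (m \<otimes> pure_tensor (xs @ a # b # ys)) =
          f (m \<otimes> pure_tensor (multiply_at i (xs @ a # b # ys)))"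
        by (simp add: inner_coface_pure[OF fV] flip: dD)
      also have "multiply_at i (xs @ a # b # ys) = xs @ (a * b) # ys"
        using xs by (simp add: multiply_at_def nth_append)
      finally show "D (m \<otimes> pure_tensor (xs @ a # b # ys)) = F (m \<otimes> pure_tensor (xs @ (a * b) # ys))"
        using len' by (simp add: fF)
    qed (intro coefficient_linear_intros clinear_comp[OF F] clinear_comp[OF D])+
    also have "\<dots> = coface (Suc n) i f (m \<otimes> diag_list h as)"
      unfolding as[symmetric] using len by (simp add: dD in_power)
    finally show ?thesis .
  qed
  with dV show ?thesis by (simp add: cochains_iff)
qed

lemma codegeneracy_cochain:
  assumes i: "i \<le> n" and f: "f \<in> cochains (Suc n)"
  shows "codegeneracy n i f \<in> cochains n"
proof -
  have fV: "f \<in> all_functionals (Suc n)" using f by (simp add: cochains_iff)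
  have sV: "codegeneracy n i f \<in> all_functionals n" by (rule codegeneracy_functional[OF fV i])
  have "codegeneracy n i f ((m \<lhd> h) \<otimes> pure_tensor as) = codegeneracy n i f (m \<otimes> diag_list h as)"
    if len: "length as = n + 1" for m h as
  proof -
    obtain F where F: "clinear F"
      and fF: "\<And>m x. x \<in> tensor_power (Suc n + 1) \<Longrightarrow> f (m \<otimes> x) = F (m \<otimes> x)"
        "\<And>m as. length as = Suc n + 1 \<Longrightarrow> f (m \<otimes> pure_tensor as) = F (m \<otimes> pure_tensor as)"
      by (rule functional_evaluation_linear[OF fV]) blast
    obtain D where D: "clinear D"
      and dD: "\<And>m x. x \<in> tensor_power (n + 1) \<Longrightarrow> codegeneracy n i f (m \<otimes> x) = D (m \<otimes> x)"
        "\<And>m as. length as = n + 1 \<Longrightarrow> codegeneracy n i f (m \<otimes> pure_tensor as) = D (m \<otimes> pure_tensor as)"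
      by (rule functional_evaluation_linear[OF sV]) blast
    have in_power: "diag_list h bs \<in> tensor_power k" if "length bs = k" for bs k
      using that diag_list_in_tensor_power by blast
    let ?xs = "take (i + 1) as" and ?ys = "drop (i + 1) as"
    have "codegeneracy n i f ((m \<lhd> h) \<otimes> pure_tensor as) =
        f (m \<otimes> diag_list h (insert_unit (Suc i) as))"
      using f i len by (simp add: codegeneracy_pure_insert[OF fV] cochains_iff del: insert_unit_simps)
    also have "\<dots> = F (m \<otimes> diag_list h (insert_unit (Suc i) as))"
      using i len by (intro fF in_power) simp
    also have "\<dots> = F (m \<otimes> diag_list h (?xs @ 1 # ?ys))"
      by (simp add: insert_unit_def)
    also have "\<dots> = D (m \<otimes> diag_list h (?xs @ ?ys))"
    proof (rule diag_list_unit)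
      fix xs ys :: "'a list"
      assume "length xs = length ?xs" "length ys = length ?ys"
      then have len': "length (xs @ ys) = n + 1" and xs: "length xs = i + 1"
        using i len by simp_all
      then have "D (m \<otimes> pure_tensor (xs @ ys)) =
          f (m \<otimes> pure_tensor (insert_unit (Suc i) (xs @ ys)))"
        by (simp add: codegeneracy_pure_insert[OF fV] flip: dD)
      also have "insert_unit (Suc i) (xs @ ys) = xs @ 1 # ys"
        using xs by (simp add: insert_unit_def)
      finally show "F (m \<otimes> pure_tensor (xs @ 1 # ys)) = D (m \<otimes> pure_tensor (xs @ ys))"
        using len' by (simp add: fF)
    qed (intro coefficient_linear_intros clinear_comp[OF F] clinear_comp[OF D])+
    also have "\<dots> = codegeneracy n i f (m \<otimes> diag_list h as)"
      using len by (simp add: dD in_power)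
    finally show ?thesis .
  qed
  with sV show ?thesis by (simp add: cochains_iff)
qed

lemma inner_coface_coface:
  assumes "i \<le> j" "j \<le> n" and f: "f \<in> all_functionals n"
  shows "coface (Suc (Suc n)) (Suc j) (coface (Suc n) i f) = coface (Suc (Suc n)) i (coface (Suc n) j f)"
  by (rule functionals_eqI[of _ "Suc (Suc n)"])
    (use assms in \<open>simp_all add: inner_operator_simps multiply_at_multiply_at\<close>)

lemma codegeneracy_codegeneracy:
  assumes "i \<le> j" "j \<le> n" and f: "f \<in> all_functionals (Suc (Suc n))"
  shows "codegeneracy n j (codegeneracy (Suc n) i f) = codegeneracy n i (codegeneracy (Suc n) (Suc j) f)"
  by (rule functionals_eqI[of _ n])
    (use assms in \<open>simp_all add: inner_operator_simps insert_unit_insert_unit[of "Suc i" "Suc j"]\<close>)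

lemma codegeneracy_coface_less:
  assumes "i \<le> j" "j \<le> n" and f: "f \<in> all_functionals (Suc n)"
  shows "codegeneracy (Suc n) (Suc j) (coface (Suc (Suc n)) i f) = coface (Suc n) i (codegeneracy n j f)"
  by (rule functionals_eqI[of _ "Suc n"])
    (use assms in \<open>simp_all add: inner_operator_simps multiply_at_insert_unit_greater\<close>)

lemma codegeneracy_coface_same:
  assumes "j \<le> n" and f: "f \<in> all_functionals n"
  shows "codegeneracy n j (coface (Suc n) j f) = f"
  by (rule functionals_eqI[OF _ f])
    (use assms in \<open>simp_all add: inner_operator_simps multiply_at_insert_unit_Suc\<close>)

lemma codegeneracy_inner_coface_Suc:
  assumes "j < n" and f: "f \<in> all_functionals n"
  shows "codegeneracy n j (coface (Suc n) (Suc j) f) = f"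
  by (rule functionals_eqI[OF _ f])
    (use assms in \<open>simp_all add: inner_operator_simps multiply_at_insert_unit\<close>)

lemma codegeneracy_inner_coface_greater:
  assumes "j < i" "i \<le> n" and f: "f \<in> all_functionals (Suc n)"
  shows "codegeneracy (Suc n) j (coface (Suc (Suc n)) (Suc i) f) = coface (Suc n) i (codegeneracy n j f)"
  by (rule functionals_eqI[of _ "Suc n"])
    (use assms in \<open>simp_all add: inner_operator_simps multiply_at_insert_unit_less\<close>)


section \<open>The cyclic operator\<close>

context
  assumes bij_S: "bij S"
begin

lemmas cyclic_linear_intros = coefficient_linear_intros
  clinear_comp[OF inverse_antipode_linear[OF bij_S]]

lemma cyclic_functional: "f \<in> all_functionals n \<Longrightarrow> cyclic n f \<in> all_functionals n"
  by (rule cyclic_in[OF bij_S])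

lemma cyclic_snoc:
  assumes "f \<in> all_functionals n" "length as = n"
  shows "cyclic n f (m \<otimes> pure_tensor (as @ [a])) =
    sweedler (\<rho> m) (\<lambda>h m'. f (m' \<otimes> pure_tensor ((S_inv h \<rhd> a) # as)))"
  using cyclic_pure[OF bij_S assms(1), of "as @ [a]" m] assms(2) by simp

lemma functionals_snoc_eqI:
  assumes "f \<in> all_functionals n" "g \<in> all_functionals n"
    and "\<And>m as a. length as = n \<Longrightarrow> f (m \<otimes> pure_tensor (as @ [a])) = g (m \<otimes> pure_tensor (as @ [a]))"
  shows "f = g"
proof (rule functionals_eqI[OF assms(1,2)])
  fix m :: 'm and as :: "'a list" assume "length as = n + 1"
  then obtain bs a where "as = bs @ [a]" "length bs = n" by (cases as rule: rev_cases) auto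
  then show "f (m \<otimes> pure_tensor as) = g (m \<otimes> pure_tensor as)" using assms(3) by simp
qed

lemma cyclic_linear: "clinear_on (all_functionals n) (cyclic n)"
proof -
  note V = functionals_add[OF subspace_coeff_tensor] functionals_scaleC[OF subspace_coeff_tensor]
  have bil: "cbilinear (\<lambda>h m'. f (m' \<otimes> pure_tensor ((S_inv h \<rhd> a) # as)))"
    if f: "f \<in> all_functionals n" and len: "length as = n" for f a as
  proof -
    obtain F where F: "clinear F"
      and fF: "\<And>m as. length as = n + 1 \<Longrightarrow> f (m \<otimes> pure_tensor as) = F (m \<otimes> pure_tensor as)"
      by (rule functional_pure_linear[OF f]) blast
    have "cbilinear (\<lambda>h m'. F (m' \<otimes> tensor_cons (S_inv h \<rhd> a) (pure_tensor as)))"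
      by (intro cyclic_linear_intros clinear_comp[OF F])
    then show ?thesis using len by (simp add: fF tensor_cons_pure)
  qed
  have "cyclic n (f + g) = cyclic n f + cyclic n g"
    if fg: "f \<in> all_functionals n" "g \<in> all_functionals n" for f g
    by (rule functionals_snoc_eqI[of _ n])
      (use fg in \<open>simp_all add: V cyclic_functional cyclic_snoc sweedler_add bil\<close>)
  moreover have "cyclic n (c *\<^sub>C f) = c *\<^sub>C cyclic n f" if f: "f \<in> all_functionals n" for c f
  proof (rule functionals_snoc_eqI[of _ n])
    have scale: "clinear (\<lambda>x::complex. c *\<^sub>C x)" by (intro linear_intros)
    show "cyclic n (c *\<^sub>C f) (m \<otimes> pure_tensor (as @ [a])) =
        (c *\<^sub>C cyclic n f) (m \<otimes> pure_tensor (as @ [a]))" if "length as = n" for m as a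
      using that f linear_sweedler[OF scale bil[OF f]]
      by (simp add: V cyclic_snoc scaleC_apply)
  qed (use f in \<open>simp_all add: V cyclic_functional\<close>)
  ultimately show ?thesis by (simp add: clinear_on_def)
qed

text \<open>The axiom \<open>t d\<^sub>0 = d\<^sub>n\<close>, read as a reduction of the last coface to operators that are easier to
  commute past each other.\<close>

lemma last_coface_eq:
  assumes f: "f \<in> all_functionals n"
  shows "coface (Suc n) (Suc n) f = cyclic (Suc n) (coface (Suc n) 0 f)"
proof (rule functionals_snoc_eqI)
  show "coface (Suc n) (Suc n) f \<in> all_functionals (Suc n)"
    using last_coface_in[OF bij_S, of "Suc n" f] f by simp
  show "cyclic (Suc n) (coface (Suc n) 0 f) \<in> all_functionals (Suc n)"
    by (intro cyclic_functional inner_coface_functional f) simp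
  fix m :: 'm and as :: "'a list" and a assume len: "length as = Suc n"
  then obtain b bs where as: "as = b # bs" by (cases as) auto
  then show "coface (Suc n) (Suc n) f (m \<otimes> pure_tensor (as @ [a])) =
      cyclic (Suc n) (coface (Suc n) 0 f) (m \<otimes> pure_tensor (as @ [a]))"
    using last_coface_pure[OF bij_S, of "Suc n" f bs m b a]
      cyclic_snoc[of "coface (Suc n) 0 f" "Suc n" "b # bs" m a] f len
    by (simp add: inner_operator_simps)
qed

lemma coface_functional:
  "f \<in> all_functionals n \<Longrightarrow> i \<le> Suc n \<Longrightarrow> coface (Suc n) i f \<in> all_functionals (Suc n)"
  by (cases "i = Suc n") (simp_all add: last_coface_eq cyclic_functional inner_coface_functional)

lemmas operator_simps = inner_operator_simps coface_functional cyclic_functional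

lemma cyclic_inner_coface:
  assumes "i < n" and f: "f \<in> all_functionals n"
  shows "cyclic (Suc n) (coface (Suc n) (Suc i) f) = coface (Suc n) i (cyclic n f)"
proof (rule functionals_snoc_eqI[of _ "Suc n"])
  fix m :: 'm and as :: "'a list" and a assume "length as = Suc n"
  with assms show "cyclic (Suc n) (coface (Suc n) (Suc i) f) (m \<otimes> pure_tensor (as @ [a])) =
      coface (Suc n) i (cyclic n f) (m \<otimes> pure_tensor (as @ [a]))"
    by (simp add: cyclic_snoc operator_simps multiply_at_append)
qed (use assms in \<open>simp_all add: operator_simps\<close>)

lemma cyclic_codegeneracy:
  assumes "i < n" and f: "f \<in> all_functionals (Suc n)"
  shows "cyclic n (codegeneracy n (Suc i) f) = codegeneracy n i (cyclic (Suc n) f)"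
proof (rule functionals_snoc_eqI[of _ n])
  fix m :: 'm and as :: "'a list" and a assume "length as = n"
  with assms show "cyclic n (codegeneracy n (Suc i) f) (m \<otimes> pure_tensor (as @ [a])) =
      codegeneracy n i (cyclic (Suc n) f) (m \<otimes> pure_tensor (as @ [a]))"
    by (simp add: cyclic_snoc operator_simps insert_unit_append)
qed (use assms in \<open>simp_all add: operator_simps\<close>)

text \<open>Two successive coactions put \<open>S\<^sup>-\<^sup>1(h\<^sub>2) b\<close> in front of \<open>S\<^sup>-\<^sup>1(h\<^sub>1) c\<close>. Since \<open>S\<^sup>-\<^sup>1\<close> reverses the
  coproduct, their product is \<open>S\<^sup>-\<^sup>1(h) (b c)\<close>, the letter that \<open>t\<close> produces from \<open>b c\<close>.\<close>

lemma cyclic_last_coface: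
  assumes f: "f \<in> all_functionals n"
  shows "cyclic (Suc n) (coface (Suc n) (Suc n) f) = coface (Suc n) n (cyclic n f)"
proof (rule functionals_snoc_eqI[of _ "Suc n"])
  obtain F where F: "clinear F"
    and fF: "\<And>m as. length as = n + 1 \<Longrightarrow> f (m \<otimes> pure_tensor as) = F (m \<otimes> pure_tensor as)"
    by (rule functional_pure_linear[OF f]) blast
  note intros = cyclic_linear_intros clinear_comp[OF F]
  fix m :: 'm and as :: "'a list" and c assume "length as = Suc n"
  then obtain bs b where as: "as = bs @ [b]" and len: "length bs = n" by (cases as rule: rev_cases) auto
  let ?x = "pure_tensor bs"
  have d: "coface (Suc n) (Suc n) f (m \<otimes> pure_tensor (a # bs @ [b])) =
      sweedler (\<rho> m) (\<lambda>k m'. F (m' \<otimes> tensor_cons ((S_inv k \<rhd> b) * a) ?x))" for m a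
    using last_coface_pure[OF bij_S, of "Suc n" f bs m a b] f len by (simp add: fF tensor_cons_pure)
  have "cyclic (Suc n) (coface (Suc n) (Suc n) f) (m \<otimes> pure_tensor (as @ [c])) =
      sweedler (\<rho> m) (\<lambda>h m'. sweedler (\<rho> m') (\<lambda>k m''.
        F (m'' \<otimes> tensor_cons ((S_inv k \<rhd> b) * (S_inv h \<rhd> c)) ?x)))"
    using len f by (subst cyclic_snoc) (simp_all add: coface_functional as d)
  also have "\<dots> = sweedler (\<rho> m) (\<lambda>h m'. sweedler (\<Delta> h) (\<lambda>h1 h2.
        F (m' \<otimes> tensor_cons ((S_inv h2 \<rhd> b) * (S_inv h1 \<rhd> c)) ?x)))"
    by (intro sweedler_coaction[symmetric] intros)
  also have "\<dots> = sweedler (\<rho> m) (\<lambda>h m'. sweedler (\<Delta> (S_inv h)) (\<lambda>h1 h2.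
        F (m' \<otimes> tensor_cons ((h1 \<rhd> b) * (h2 \<rhd> c)) ?x)))"
    by (intro sweedler_cong sweedler_inverse_antipode[OF bij_S, symmetric] intros)
  also have "\<dots> = sweedler (\<rho> m) (\<lambda>h m'. F (m' \<otimes> tensor_cons (S_inv h \<rhd> (b * c)) ?x))"
    unfolding act_prod by (intro sweedler_cong linear_sweedler[symmetric] intros)
  also have "\<dots> = coface (Suc n) n (cyclic n f) (m \<otimes> pure_tensor (as @ [c]))"
    using len f multiply_at_last[of bs b c]
    by (simp add: operator_simps as cyclic_snoc fF tensor_cons_pure)
  finally show "cyclic (Suc n) (coface (Suc n) (Suc n) f) (m \<otimes> pure_tensor (as @ [c])) =
      coface (Suc n) n (cyclic n f) (m \<otimes> pure_tensor (as @ [c]))" .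
qed (use assms in \<open>simp_all add: operator_simps\<close>)

text \<open>On the right-hand side the first rotation moves the appended unit to the front. There
  \<open>S\<^sup>-\<^sup>1(h)\<close> acts on it by \<open>\<epsilon>(h)\<close>, so the counit cancels one of the two coactions.\<close>

lemma cyclic_codegeneracy_0:
  assumes f: "f \<in> all_functionals (Suc n)"
  shows "cyclic n (codegeneracy n 0 f) = codegeneracy n n (cyclic (Suc n) (cyclic (Suc n) f))"
proof (rule functionals_snoc_eqI[of _ n])
  obtain F where F: "clinear F"
    and fF: "\<And>m as. length as = Suc n + 1 \<Longrightarrow> f (m \<otimes> pure_tensor as) = F (m \<otimes> pure_tensor as)"
    by (rule functional_pure_linear[OF f]) blast
  note intros = cyclic_linear_intros clinear_comp[OF F]
  fix m :: 'm and as :: "'a list" and a assume len: "length as = n"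
  let ?x = "tensor_cons 1 (pure_tensor as)"
  have t: "cyclic (Suc n) f (m \<otimes> pure_tensor (b # as @ [a])) =
      sweedler (\<rho> m) (\<lambda>h m'. F (m' \<otimes> tensor_cons (S_inv h \<rhd> a) (tensor_cons b (pure_tensor as))))" for m b
    using cyclic_snoc[OF f, of "b # as"] len by (simp add: fF tensor_cons_pure)
  have "codegeneracy n n (cyclic (Suc n) (cyclic (Suc n) f)) (m \<otimes> pure_tensor (as @ [a])) =
      cyclic (Suc n) (cyclic (Suc n) f) (m \<otimes> pure_tensor ((as @ [a]) @ [1]))"
    using len f insert_unit_length[of "as @ [a]"] by (simp add: operator_simps)
  also have "\<dots> = sweedler (\<rho> m) (\<lambda>h m'. sweedler (\<rho> m') (\<lambda>k m''.
      F (m'' \<otimes> tensor_cons (S_inv k \<rhd> a) (tensor_cons (\<epsilon> h *\<^sub>C 1) (pure_tensor as)))))"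
    using len f by (subst cyclic_snoc)
      (simp_all add: cyclic_functional t act_unit counit_inverse_antipode[OF bij_S])
  also have "\<dots> = sweedler (\<rho> m) (\<lambda>h m'. sweedler (\<Delta> h) (\<lambda>h1 h2.
      F (m' \<otimes> tensor_cons (S_inv h2 \<rhd> a) (tensor_cons (\<epsilon> h1 *\<^sub>C 1) (pure_tensor as)))))"
    by (intro sweedler_coaction[symmetric] intros)
  also have "\<dots> = sweedler (\<rho> m) (\<lambda>h m'. sweedler (\<Delta> h) (\<lambda>h1 h2.
      \<epsilon> h1 *\<^sub>C F (m' \<otimes> tensor_cons (S_inv h2 \<rhd> a) ?x)))"
    by (simp add: clinear_scaleC[OF clinear_left[OF cbilinear_tensor_cons]] clinear_scaleC[OF F]
        clinear_scaleC[OF clinear_right[OF cbilinear_tensor_cons]]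
        clinear_scaleC[OF clinear_right[OF cbilinear_tensor_pure]])
  also have "\<dots> = sweedler (\<rho> m) (\<lambda>h m'. F (m' \<otimes> tensor_cons (S_inv h \<rhd> a) ?x))"
    by (intro sweedler_cong sweedler_counit_left intros)
  also have "\<dots> = cyclic n (codegeneracy n 0 f) (m \<otimes> pure_tensor (as @ [a]))"
    using len f by (simp add: cyclic_snoc operator_simps fF tensor_cons_pure)
  finally show "cyclic n (codegeneracy n 0 f) (m \<otimes> pure_tensor (as @ [a])) =
      codegeneracy n n (cyclic (Suc n) (cyclic (Suc n) f)) (m \<otimes> pure_tensor (as @ [a]))" by simp
qed (use assms in \<open>simp_all add: operator_simps\<close>)

lemma cyclic_power_functional: "f \<in> all_functionals n \<Longrightarrow> (cyclic n ^^ k) f \<in> all_functionals n"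
  by (induct k) (simp_all add: cyclic_functional)

text \<open>Each rotation takes one more letter from the end of the word and acts on it with one more
  coaction factor. Collected, the factors form the iterated coproduct of \<open>S\<^sup>-\<^sup>1(m\<^sub>-\<^sub>1)\<close> in the right
  order, that is, the diagonal action on the rotated letters \<open>bs\<close>.\<close>

lemma cyclic_power_pure:
  assumes f: "f \<in> all_functionals n" and F: "clinear F"
    and fF: "\<And>m as. length as = n + 1 \<Longrightarrow> f (m \<otimes> pure_tensor as) = F (m \<otimes> pure_tensor as)"
    and len: "length as + length bs = n + 1"
  shows "(cyclic n ^^ length bs) f (m \<otimes> pure_tensor (as @ bs)) =
    sweedler (\<rho> m) (\<lambda>h m'. F (m' \<otimes> tensor_append (diag_list (S_inv h) bs) (pure_tensor as)))"
  using len
proof (induct bs arbitrary: as m rule: rev_induct)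
  note intros = cyclic_linear_intros clinear_comp[OF F]
  case Nil
  have "sweedler (\<rho> m) (\<lambda>h m'. \<epsilon> h *\<^sub>C F (m' \<otimes> pure_tensor as)) = F (m \<otimes> pure_tensor as)"
    by (intro sweedler_coaction_counit intros)
  with Nil show ?case
    by (simp add: fF counit_inverse_antipode[OF bij_S] tensor_append_Nil clinear_scaleC[OF F]
        clinear_scaleC[OF clinear_left[OF cbilinear_tensor_append]]
        clinear_scaleC[OF clinear_right[OF cbilinear_tensor_pure]])
next
  note intros = cyclic_linear_intros clinear_comp[OF F]
  case (snoc b bs)
  let ?t = "cyclic n ^^ length bs" and ?x = "pure_tensor as"
  have "(cyclic n ^^ length (bs @ [b])) f (m \<otimes> pure_tensor (as @ bs @ [b])) =
      cyclic n (?t f) (m \<otimes> pure_tensor ((as @ bs) @ [b]))"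
    by simp
  also have "\<dots> = sweedler (\<rho> m) (\<lambda>h m'. ?t f (m' \<otimes> pure_tensor (((S_inv h \<rhd> b) # as) @ bs)))"
    using snoc(2) f by (subst cyclic_snoc) (simp_all add: cyclic_power_functional)
  also have "\<dots> = sweedler (\<rho> m) (\<lambda>h m'. sweedler (\<rho> m') (\<lambda>k m''.
      F (m'' \<otimes> tensor_append (diag_list (S_inv k) bs) (tensor_cons (S_inv h \<rhd> b) ?x))))"
    using snoc by (subst snoc(1)) (simp_all add: tensor_cons_pure)
  also have "\<dots> = sweedler (\<rho> m) (\<lambda>h m'. sweedler (\<Delta> h) (\<lambda>h1 h2.
      F (m' \<otimes> tensor_append (diag_list (S_inv h2) bs) (tensor_cons (S_inv h1 \<rhd> b) ?x))))"
    by (intro sweedler_coaction[symmetric] intros)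
  also have "\<dots> = sweedler (\<rho> m) (\<lambda>h m'. sweedler (\<Delta> (S_inv h)) (\<lambda>h1 h2.
      F (m' \<otimes> tensor_append (diag_list h1 bs) (tensor_cons (h2 \<rhd> b) ?x))))"
    by (intro sweedler_cong sweedler_inverse_antipode[OF bij_S, symmetric] intros)
  also have "\<dots> = sweedler (\<rho> m) (\<lambda>h m'. sweedler (\<Delta> (S_inv h)) (\<lambda>h1 h2.
      F (m' \<otimes> tensor_append (tensor_append (diag_list h1 bs) (tensor_cons (h2 \<rhd> b) (pure_tensor []))) ?x)))"
    by (simp add: tensor_append_assoc tensor_append_cons tensor_append_Nil)
  also have "\<dots> = sweedler (\<rho> m) (\<lambda>h m'. F (m' \<otimes> tensor_append (diag_list (S_inv h) (bs @ [b])) ?x))"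
    unfolding diag_list_snoc by (intro sweedler_cong linear_sweedler[symmetric] intros)
  finally show ?case .
qed

lemma codegeneracy_last_coface:
  assumes f: "f \<in> all_functionals n"
  shows "codegeneracy n n (coface (Suc n) (Suc n) f) = f"
proof (rule functionals_eqI[OF _ f])
  obtain F where F: "clinear F"
    and fF: "\<And>m as. length as = n + 1 \<Longrightarrow> f (m \<otimes> pure_tensor as) = F (m \<otimes> pure_tensor as)"
    by (rule functional_pure_linear[OF f]) blast
  fix m :: 'm and as :: "'a list" assume "length as = n + 1"
  then obtain b bs where as: "as = b # bs" and len: "length bs = n" by (cases as) auto
  have "codegeneracy n n (coface (Suc n) (Suc n) f) (m \<otimes> pure_tensor as) =
      coface (Suc n) (Suc n) f (m \<otimes> pure_tensor (b # bs @ [1]))"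
    using len f insert_unit_length[of bs] by (simp add: operator_simps as)
  also have "\<dots> = sweedler (\<rho> m) (\<lambda>h m'. F (m' \<otimes> tensor_cons (\<epsilon> h *\<^sub>C b) (pure_tensor bs)))"
    using last_coface_pure[OF bij_S, of "Suc n" f bs m b 1] f len
    by (simp add: fF tensor_cons_pure act_unit counit_inverse_antipode[OF bij_S] scaleC_mult_left)
  also have "\<dots> = sweedler (\<rho> m) (\<lambda>h m'. \<epsilon> h *\<^sub>C F (m' \<otimes> pure_tensor as))"
    by (simp add: as clinear_scaleC[OF clinear_left[OF cbilinear_tensor_cons]] clinear_scaleC[OF F]
        clinear_scaleC[OF clinear_right[OF cbilinear_tensor_pure]] flip: tensor_cons_pure)
  also have "\<dots> = F (m \<otimes> pure_tensor as)"
    by (intro sweedler_coaction_counit cyclic_linear_intros clinear_comp[OF F])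
  also have "\<dots> = f (m \<otimes> pure_tensor as)"
    using len by (simp add: fF as)
  finally show "codegeneracy n n (coface (Suc n) (Suc n) f) (m \<otimes> pure_tensor as) =
      f (m \<otimes> pure_tensor as)" .
qed (use assms in \<open>simp add: operator_simps\<close>)

text \<open>When \<open>d\<^sub>n = t d\<^sub>0\<close> is the outer coface only, moving \<open>d\<^sub>i\<close> past \<open>d\<^sub>0\<close> and then past \<open>t\<close> suffices. When
  both cofaces are last ones, \<open>t d\<^sub>0 t d\<^sub>0 = t t d\<^sub>1 d\<^sub>0 = t t d\<^sub>0 d\<^sub>0\<close>, in which \<open>t d\<^sub>0\<close> is again a last
  coface, to be moved past the remaining \<open>t\<close>.\<close>

lemma coface_coface:
  assumes "i \<le> j" "j \<le> Suc n" and f: "f \<in> all_functionals n"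
  shows "coface (Suc (Suc n)) (Suc j) (coface (Suc n) i f) = coface (Suc (Suc n)) i (coface (Suc n) j f)"
proof -
  let ?d = "coface (Suc (Suc n))" and ?d' = "coface (Suc n)" and ?t = "cyclic (Suc (Suc n))"
  note V = f inner_coface_functional coface_functional
  consider "j \<le> n" | "j = Suc n" "i \<le> n" | "j = Suc n" "i = Suc n" using assms by linarith
  then show ?thesis
  proof cases
    case 1
    then show ?thesis using assms by (simp add: inner_coface_coface)
  next
    case 2
    have "?d (Suc j) (?d' i f) = ?t (?d 0 (?d' i f))"
      using 2 V by (simp add: last_coface_eq)
    also have "\<dots> = ?t (?d (Suc i) (?d' 0 f))"
      using 2 f by (simp add: inner_coface_coface)
    also have "\<dots> = ?d i (cyclic (Suc n) (?d' 0 f))"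
      using 2 V by (simp add: cyclic_inner_coface)
    finally show ?thesis using 2 f by (simp add: last_coface_eq)
  next
    case 3
    have "?d (Suc j) (?d' i f) = ?t (?d 0 (cyclic (Suc n) (?d' 0 f)))"
      using 3 V by (simp add: last_coface_eq cyclic_functional)
    also have "\<dots> = ?t (?t (?d (Suc 0) (?d' 0 f)))"
      using V by (simp add: cyclic_inner_coface)
    also have "\<dots> = ?t (?t (?d 0 (?d' 0 f)))"
      using f by (simp add: inner_coface_coface)
    also have "\<dots> = ?t (?d (Suc (Suc n)) (?d' 0 f))"
      using V by (simp add: last_coface_eq)
    also have "\<dots> = ?d (Suc n) (cyclic (Suc n) (?d' 0 f))"
      using V by (simp add: cyclic_last_coface)
    finally show ?thesis using 3 f by (simp add: last_coface_eq)
  qed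
qed

lemma codegeneracy_last_coface_commute:
  assumes "j \<le> n" and f: "f \<in> all_functionals (Suc n)"
  shows "codegeneracy (Suc n) j (coface (Suc (Suc n)) (Suc (Suc n)) f) =
    coface (Suc n) (Suc n) (codegeneracy n j f)"
proof -
  have "codegeneracy (Suc n) j (coface (Suc (Suc n)) (Suc (Suc n)) f) =
      codegeneracy (Suc n) j (cyclic (Suc (Suc n)) (coface (Suc (Suc n)) 0 f))"
    using f by (simp add: last_coface_eq)
  also have "\<dots> = cyclic (Suc n) (codegeneracy (Suc n) (Suc j) (coface (Suc (Suc n)) 0 f))"
    using assms by (simp add: cyclic_codegeneracy operator_simps)
  also have "\<dots> = cyclic (Suc n) (coface (Suc n) 0 (codegeneracy n j f))"
    using assms by (simp add: codegeneracy_coface_less)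
  finally show ?thesis using assms by (simp add: last_coface_eq operator_simps)
qed

lemma codegeneracy_coface_Suc:
  assumes "j \<le> n" and f: "f \<in> all_functionals n"
  shows "codegeneracy n j (coface (Suc n) (Suc j) f) = f"
  using assms by (cases "j = n") (simp_all add: codegeneracy_last_coface codegeneracy_inner_coface_Suc)

lemma codegeneracy_coface_greater:
  assumes "j < i" "i \<le> Suc n" and f: "f \<in> all_functionals (Suc n)"
  shows "codegeneracy (Suc n) j (coface (Suc (Suc n)) (Suc i) f) = coface (Suc n) i (codegeneracy n j f)"
  using assms
  by (cases "i = Suc n") (simp_all add: codegeneracy_last_coface_commute codegeneracy_inner_coface_greater)

lemma cyclic_coface:
  "i \<le> n \<Longrightarrow> f \<in> all_functionals n \<Longrightarrow>
    cyclic (Suc n) (coface (Suc n) (Suc i) f) = coface (Suc n) i (cyclic n f)"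
  by (cases "i = n") (simp_all add: cyclic_last_coface cyclic_inner_coface)

lemma codegeneracy_linear:
  assumes "i \<le> n" shows "clinear_on (all_functionals (Suc n)) (codegeneracy n i)"
proof -
  note V = functionals_add[OF subspace_coeff_tensor] functionals_scaleC[OF subspace_coeff_tensor]
  have "codegeneracy n i (f + g) = codegeneracy n i f + codegeneracy n i g"
    if "f \<in> all_functionals (Suc n)" "g \<in> all_functionals (Suc n)" for f g
    by (rule functionals_eqI[of _ n]) (use that assms in \<open>simp_all add: V operator_simps\<close>)
  moreover have "codegeneracy n i (c *\<^sub>C f) = c *\<^sub>C codegeneracy n i f"
    if f: "f \<in> all_functionals (Suc n)" for f c
    by (rule functionals_eqI[of _ n])
      (use f assms in \<open>simp_all add: V operator_simps scaleC_apply\<close>)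
  ultimately show ?thesis by (simp add: clinear_on_def)
qed

lemma coface_linear:
  assumes "i \<le> Suc n" shows "clinear_on (all_functionals n) (coface (Suc n) i)"
proof -
  note V = functionals_add[OF subspace_coeff_tensor] functionals_scaleC[OF subspace_coeff_tensor]
  have inner: "clinear_on (all_functionals n) (coface (Suc n) i)" if "i \<le> n" for i
  proof -
    have "coface (Suc n) i (f + g) = coface (Suc n) i f + coface (Suc n) i g"
      if "f \<in> all_functionals n" "g \<in> all_functionals n" for f g
      by (rule functionals_eqI[of _ "Suc n"]) (use that \<open>i \<le> n\<close> in \<open>simp_all add: V operator_simps\<close>)
    moreover have "coface (Suc n) i (c *\<^sub>C f) = c *\<^sub>C coface (Suc n) i f"
      if f: "f \<in> all_functionals n" for f c
      by (rule functionals_eqI[of _ "Suc n"])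
        (use f \<open>i \<le> n\<close> in \<open>simp_all add: V operator_simps scaleC_apply\<close>)
    ultimately show ?thesis by (simp add: clinear_on_def)
  qed
  show ?thesis
  proof (cases "i \<le> n")
    case False
    then have "i = Suc n" using assms by simp
    then show ?thesis
      using inner[of 0] cyclic_linear[of "Suc n"]
      by (simp add: clinear_on_def V last_coface_eq inner_coface_functional)
  qed (rule inner)
qed

end

end


section \<open>Stable anti-Yetter-Drinfeld coefficients\<close>

context AH_SAYD
begin

context
  assumes bij_S: "bij S"
begin

text \<open>The anti-Yetter-Drinfeld condition rewrites the coaction of \<open>m h\<close>. The factor \<open>h\<^sub>2\<close> that it leaves
  on \<open>m\<^sub>0\<close> moves over to the word, because \<open>f\<close> is \<open>H\<close>-linear; its part on the first letter cancels
  against \<open>S\<^sup>-\<^sup>1(h\<^sub>1)\<close>, and what remains is the diagonal action on the original word.\<close>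

lemma cyclic_cochain:
  assumes f: "f \<in> cochains n" shows "cyclic n f \<in> cochains n"
proof -
  have fV: "f \<in> all_functionals n" using f by (simp add: cochains_iff)
  have tV: "cyclic n f \<in> all_functionals n" by (rule cyclic_functional[OF bij_S fV])
  obtain F where F: "clinear F"
    and fF: "\<And>m x. x \<in> tensor_power (n + 1) \<Longrightarrow> f (m \<otimes> x) = F (m \<otimes> x)"
      "\<And>m as. length as = n + 1 \<Longrightarrow> f (m \<otimes> pure_tensor as) = F (m \<otimes> pure_tensor as)"
    by (rule functional_evaluation_linear[OF fV]) blast
  obtain T where T: "clinear T"
    and tT: "\<And>m x. x \<in> tensor_power (n + 1) \<Longrightarrow> cyclic n f (m \<otimes> x) = T (m \<otimes> x)"
      "\<And>m as. length as = n + 1 \<Longrightarrow> cyclic n f (m \<otimes> pure_tensor as) = T (m \<otimes> pure_tensor as)"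
    by (rule functional_evaluation_linear[OF tV]) blast
  note intros = cyclic_linear_intros bij_S clinear_comp[OF F] clinear_comp[OF T]
  have hom: "F ((m \<lhd> h) \<otimes> pure_tensor as) = F (m \<otimes> diag_list h as)" if "length as = n + 1" for m h as
  proof -
    have "diag_list h as \<in> tensor_power (n + 1)" using that diag_list_in_tensor_power[of h as] by simp
    then show ?thesis using f that by (simp add: cochains_iff flip: fF)
  qed
  have T_append: "T (m \<otimes> tensor_append x (tensor_cons a (pure_tensor []))) =
      sweedler (\<rho> m) (\<lambda>k m'. F (m' \<otimes> tensor_cons (S_inv k \<rhd> a) x))"
    if "x \<in> tensor_power n" for m x a
  proof (rule tensor_power_eqI[OF _ _ that])
    show "T (m \<otimes> tensor_append (pure_tensor as) (tensor_cons a (pure_tensor []))) =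
        sweedler (\<rho> m) (\<lambda>k m'. F (m' \<otimes> tensor_cons (S_inv k \<rhd> a) (pure_tensor as)))"
      if len: "length as = n" for as
      using len cyclic_snoc[OF bij_S fV len, of m a]
      by (simp add: tensor_cons_pure tensor_append_pure tT fF)
  qed (intro intros)+
  have "cyclic n f ((m \<lhd> h) \<otimes> pure_tensor as) = cyclic n f (m \<otimes> diag_list h as)"
    if "length as = n + 1" for m h as
  proof -
    from that obtain bs a where as: "as = bs @ [a]" and len: "length bs = n"
      by (cases as rule: rev_cases) auto
    \<comment> \<open>The anti-Yetter-Drinfeld condition is an equation in \<open>A \<otimes> M\<close>; \<open>L\<close> evaluates \<open>f\<close> on it.\<close>
    define L where "L = tensor_lift (\<lambda>b m'. F (m' \<otimes> tensor_cons b (pure_tensor bs)))"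
    have bil: "cbilinear (\<lambda>b m'. F (m' \<otimes> tensor_cons b (pure_tensor bs)))" by (intro intros)
    have L: "clinear L" unfolding L_def by (rule clinear_tensor_lift[OF bil])
    have L_pure: "L (b \<otimes> m') = F (m' \<otimes> tensor_cons b (pure_tensor bs))" for b m'
      unfolding L_def by (rule tensor_lift_pure[OF bil])
    note intros = intros clinear_comp[OF L]
    let ?G = "\<lambda>k m' p q h3. F (m' \<otimes> tensor_cons ((p * S_inv k * h3) \<rhd> a) (diag_list q bs))"
    have "cyclic n f ((m \<lhd> h) \<otimes> pure_tensor as) =
        sweedler (\<rho> (m \<lhd> h)) (\<lambda>k m'. L ((S_inv k \<rhd> a) \<otimes> m'))"
      using len by (simp add: as cyclic_snoc[OF bij_S fV] L_pure fF tensor_cons_pure)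
    also have "\<dots> = L (sweedler (\<rho> (m \<lhd> h)) (\<lambda>k m'. (S_inv k \<rhd> a) \<otimes> m'))"
      by (intro linear_sweedler[symmetric] L intros)
    also have "\<dots> = L (sweedler (\<rho> m) (\<lambda>k m'. sweedler (\<Delta> h) (\<lambda>h1 h'. sweedler (\<Delta> h') (\<lambda>h2 h3.
        ((S_inv (k * h1) * h3) \<rhd> a) \<otimes> (m' \<lhd> h2)))))"
      by (simp add: anti_yetter_drinfeld)
    also have "\<dots> = sweedler (\<rho> m) (\<lambda>k m'. L (sweedler (\<Delta> h) (\<lambda>h1 h'. sweedler (\<Delta> h') (\<lambda>h2 h3.
        ((S_inv (k * h1) * h3) \<rhd> a) \<otimes> (m' \<lhd> h2)))))"
      by (intro linear_sweedler L intros)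
    also have "\<dots> = sweedler (\<rho> m) (\<lambda>k m'. sweedler (\<Delta> h) (\<lambda>h1 h'. L (sweedler (\<Delta> h') (\<lambda>h2 h3.
        ((S_inv (k * h1) * h3) \<rhd> a) \<otimes> (m' \<lhd> h2)))))"
      by (intro sweedler_cong linear_sweedler L intros)
    also have "\<dots> = sweedler (\<rho> m) (\<lambda>k m'. sweedler (\<Delta> h) (\<lambda>h1 h'. sweedler (\<Delta> h') (\<lambda>h2 h3.
        L (((S_inv (k * h1) * h3) \<rhd> a) \<otimes> (m' \<lhd> h2)))))"
      by (intro sweedler_cong linear_sweedler L intros)
    also have "\<dots> = sweedler (\<rho> m) (\<lambda>k m'. sweedler (\<Delta> h) (\<lambda>h1 h'. sweedler (\<Delta> h') (\<lambda>h2 h3.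
        sweedler (\<Delta> h2) (\<lambda>p q. F (m' \<otimes> tensor_cons ((p * S_inv (k * h1) * h3) \<rhd> a) (diag_list q bs))))))"
    proof (intro sweedler_cong)
      fix k m' h1 h2 h3
      let ?b = "(S_inv (k * h1) * h3) \<rhd> a"
      have "L (?b \<otimes> (m' \<lhd> h2)) = F (m' \<otimes> diag_list h2 (?b # bs))"
        unfolding L_pure tensor_cons_pure using len by (intro hom) simp
      also have "\<dots> = sweedler (\<Delta> h2) (\<lambda>p q. F (m' \<otimes> tensor_cons (p \<rhd> ?b) (diag_list q bs)))"
        unfolding diag_list.simps by (intro linear_sweedler intros)
      finally show "L (?b \<otimes> (m' \<lhd> h2)) = sweedler (\<Delta> h2) (\<lambda>p q.
          F (m' \<otimes> tensor_cons ((p * S_inv (k * h1) * h3) \<rhd> a) (diag_list q bs)))"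
        by (simp add: act_mult)
    qed
    \<comment> \<open>Regrouping brings \<open>p\<close>, the part of \<open>h\<^sub>2\<close> that acts on the first letter, next to \<open>h\<^sub>1\<close>.\<close>
    also have "\<dots> = sweedler (\<rho> m) (\<lambda>k m'. sweedler (\<Delta> h) (\<lambda>h1 h'. sweedler (\<Delta> h') (\<lambda>p r.
        sweedler (\<Delta> r) (\<lambda>q h3. ?G k m' (p * S_inv h1) q h3))))"
      unfolding inverse_antipode_mult[OF bij_S] mult.assoc
      by (intro sweedler_cong sweedler_coassoc intros)
    also have "\<dots> = sweedler (\<rho> m) (\<lambda>k m'. sweedler (\<Delta> h) (\<lambda>u r. sweedler (\<Delta> u) (\<lambda>h1 p.
        sweedler (\<Delta> r) (\<lambda>q h3. ?G k m' (p * S_inv h1) q h3))))"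
      by (intro sweedler_cong sweedler_coassoc[symmetric] intros)
    also have "\<dots> = sweedler (\<rho> m) (\<lambda>k m'. sweedler (\<Delta> h) (\<lambda>u r.
        \<epsilon> u *\<^sub>C sweedler (\<Delta> r) (\<lambda>q h3. ?G k m' 1 q h3)))"
      by (intro sweedler_cong sweedler_inverse_antipode_cancel[OF bij_S] intros)
    also have "\<dots> = sweedler (\<rho> m) (\<lambda>k m'. sweedler (\<Delta> h) (\<lambda>q h3. ?G k m' 1 q h3))"
      by (intro sweedler_cong sweedler_counit_left intros)
    also have "\<dots> = sweedler (\<Delta> h) (\<lambda>q h3. sweedler (\<rho> m) (\<lambda>k m'. ?G k m' 1 q h3))"
      by (intro sweedler_swap intros)
    also have "\<dots> = sweedler (\<Delta> h) (\<lambda>q h3.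
        T (m \<otimes> tensor_append (diag_list q bs) (tensor_cons (h3 \<rhd> a) (pure_tensor []))))"
      using diag_list_in_tensor_power[of _ bs] len by (simp add: T_append act_mult)
    also have "\<dots> = T (m \<otimes> diag_list h as)"
      unfolding as diag_list_snoc by (intro linear_sweedler[symmetric] intros)
    also have "\<dots> = cyclic n f (m \<otimes> diag_list h as)"
      using diag_list_in_tensor_power[of h as] that by (simp add: tT)
    finally show ?thesis .
  qed
  with tV show ?thesis by (simp add: cochains_iff)
qed

text \<open>After \<open>n + 1\<close> rotations all letters have been rotated, and \<open>cyclic_power_pure\<close> yields the
  left-hand side of the stability condition.\<close>

lemma cyclic_power_cochain:
  assumes f: "f \<in> cochains n" shows "(cyclic n ^^ (n + 1)) f = f"
proof (rule functionals_eqI[of _ n])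
  show fV: "f \<in> all_functionals n" using f by (simp add: cochains_iff)
  then show "(cyclic n ^^ (n + 1)) f \<in> all_functionals n" by (rule cyclic_power_functional[OF bij_S])
  obtain F where F: "clinear F"
    and fF: "\<And>m x. x \<in> tensor_power (n + 1) \<Longrightarrow> f (m \<otimes> x) = F (m \<otimes> x)"
      "\<And>m as. length as = n + 1 \<Longrightarrow> f (m \<otimes> pure_tensor as) = F (m \<otimes> pure_tensor as)"
    by (rule functional_evaluation_linear[OF fV]) blast
  show "(cyclic n ^^ (n + 1)) f (m \<otimes> pure_tensor as) = f (m \<otimes> pure_tensor as)"
    if len: "length as = n + 1" for m as
  proof -
    have mem: "diag_list h as \<in> tensor_power (n + 1)" for h
      using diag_list_in_tensor_power[of h as] len by simp
    have "(cyclic n ^^ (n + 1)) f (m \<otimes> pure_tensor as) =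
        sweedler (\<rho> m) (\<lambda>h m'. F (m' \<otimes> diag_list (S_inv h) as))"
      using cyclic_power_pure[OF bij_S fV F fF(2), of "[]" as m] len by (simp add: tensor_append_Nil_right)
    also have "\<dots> = sweedler (\<rho> m) (\<lambda>h m'. f (m' \<otimes> diag (S_inv h) (pure_tensor as)))"
      by (simp add: diag_pure fF(1)[OF mem])
    also have "\<dots> = f (m \<otimes> pure_tensor as)" by (rule stable[OF f len])
    finally show ?thesis .
  qed
qed

lemma coface_cochain:
  "f \<in> cochains n \<Longrightarrow> i \<le> Suc n \<Longrightarrow> coface (Suc n) i f \<in> cochains (Suc n)"
  using last_coface_eq[OF bij_S] inner_coface_cochain cyclic_cochain
  by (cases "i = Suc n") (simp_all add: cochains_iff)

end

end

theorem proposition2p18: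
  fixes \<Delta> :: "'h::complex_unital_algebra \<Rightarrow> 'h \<otimes> 'h"
    and \<epsilon> :: "'h \<Rightarrow> complex"
    and S :: "'h \<Rightarrow> 'h"
    and act :: "'h \<Rightarrow> 'a::complex_unital_algebra \<Rightarrow> 'a"
    and ract :: "'m::complex_vector \<Rightarrow> 'h \<Rightarrow> 'm"
    and \<rho> :: "'m \<Rightarrow> 'h \<otimes> 'm"
  assumes "hopf_algebra \<Delta> \<epsilon> S"
    and "bij S"
    and "left_module_algebra \<Delta> \<epsilon> S act"
    and "AH_SAYD \<Delta> \<epsilon> S act ract \<rho>"
  shows "AH_HCC \<Delta> \<epsilon> S act ract \<rho>"
proof -
  interpret AH_SAYD \<Delta> \<epsilon> S act ract \<rho> by fact
  note bij_S = \<open>bij S\<close>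
  have V [simp]: "f \<in> all_functionals n" if "f \<in> cochains n" for f n
    using that by (simp add: cochains_iff)
  have linear: "clinear_on (cochains n) g" if "clinear_on (all_functionals n) g" for g n
    using that V unfolding clinear_on_def by blast
  have "cocyclic_module cochains coface codegeneracy cyclic"
  proof unfold_locales
    fix n i j :: nat and f :: "'m \<otimes> 'a tensor_algebra \<Rightarrow> complex"
    show "complex_vector.subspace (cochains n)" by (rule subspace_cochains)
    show "coface n i f \<in> cochains n" if "n \<ge> 1" "i \<le> n" "f \<in> cochains (n - 1)"
      using that coface_cochain[OF bij_S] by (cases n) simp_all
    show "clinear_on (cochains (n - 1)) (coface n i)" if "n \<ge> 1" "i \<le> n"
      using that coface_linear[OF bij_S] by (cases n) (simp_all add: linear)
    show "codegeneracy n i f \<in> cochains n" if "i \<le> n" "f \<in> cochains (n + 1)"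
      using that by (simp add: codegeneracy_cochain)
    show "clinear_on (cochains (n + 1)) (codegeneracy n i)" if "i \<le> n"
      using that by (simp add: linear codegeneracy_linear[OF bij_S])
    show "coface (n + 1) j (coface n i f) = coface (n + 1) i (coface n (j - 1) f)"
      if "n \<ge> 1" "i < j" "j \<le> n + 1" "f \<in> cochains (n - 1)"
      using that coface_coface[OF bij_S] by (cases n; cases j) simp_all
    show "codegeneracy n j (codegeneracy (n + 1) i f) =
        codegeneracy n i (codegeneracy (n + 1) (j + 1) f)"
      if "i \<le> j" "j \<le> n" "f \<in> cochains (n + 2)"
      using that by (simp add: codegeneracy_codegeneracy)
    show "codegeneracy n j (coface (n + 1) i f) = coface n i (codegeneracy (n - 1) (j - 1) f)"
      if "i < j" "j \<le> n" "f \<in> cochains n"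
      using that by (cases n; cases j) (simp_all add: codegeneracy_coface_less)
    show "codegeneracy n j (coface (n + 1) i f) = f"
      if "i = j \<or> i = j + 1" "j \<le> n" "f \<in> cochains n"
      using that by (auto simp: codegeneracy_coface_same codegeneracy_coface_Suc[OF bij_S])
    show "codegeneracy n j (coface (n + 1) i f) = coface n (i - 1) (codegeneracy (n - 1) j f)"
      if "j + 1 < i" "i \<le> n + 1" "f \<in> cochains n"
      using that by (cases n; cases i) (simp_all add: codegeneracy_coface_greater[OF bij_S])
    show "cyclic n f \<in> cochains n" if "f \<in> cochains n"
      by (rule cyclic_cochain[OF bij_S that])
    show "clinear_on (cochains n) (cyclic n)"
      by (intro linear cyclic_linear bij_S)
    show "cyclic n (coface n i f) = coface n (i - 1) (cyclic (n - 1) f)"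
      if "1 \<le> i" "i \<le> n" "f \<in> cochains (n - 1)"
      using that by (cases n; cases i) (simp_all add: cyclic_coface[OF bij_S])
    show "cyclic n (coface n 0 f) = coface n n f" if "n \<ge> 1" "f \<in> cochains (n - 1)"
      using that by (cases n) (simp_all add: last_coface_eq[OF bij_S])
    show "cyclic n (codegeneracy n i f) = codegeneracy n (i - 1) (cyclic (n + 1) f)"
      if "1 \<le> i" "i \<le> n" "f \<in> cochains (n + 1)"
      using that by (cases i) (simp_all add: cyclic_codegeneracy[OF bij_S])
    show "cyclic n (codegeneracy n 0 f) = codegeneracy n n (cyclic (n + 1) (cyclic (n + 1) f))"
      if "f \<in> cochains (n + 1)"
      using that by (simp add: cyclic_codegeneracy_0[OF bij_S])
    show "(cyclic n ^^ (n + 1)) f = f" if "f \<in> cochains n"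
      by (rule cyclic_power_cochain[OF bij_S that])
  qed
  then show ?thesis
    by (intro AH_HCC.intro AH_HCC_axioms.intro AH_module_comodule_axioms)
qed

end
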